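(* Let $X$ be a finite biquandle, let $A$ be an abelian group, and let $\phi:X^2\to A$ be a complete (respectively through, respectively crooked) biquandle $2$-fare. Let $L$ be an oriented classical or virtual link. Then the multiset of fare values over the biquandle homset is invariant under Reidemeister moves. That is, if $D$ and $D'$ are two oriented diagrams of $L$ related by a finite sequence of oriented Reidemeister moves, then the multisets $$\{\phi(f)\ :\ f \text{ an } X\text{-coloring of } D\}\quad\text{and}\quad \{\phi(f')\ :\ f' \text{ an } X\text{-coloring of } D'\}$$ of elements of $A$ are equal, where $\phi(f)$ denotes the total complete (respectively through, respectively crooked) fare of the colored diagram.
   Context: **Biquandle.** A biquandle is a set $X$ with two binary operations $\underline{\triangleright},\overline{\triangleright}:X\times X\to X$ such that: (i) $x\,\underline{\triangleright}\,x=x\,\overline{\triangleright}\,x$ for all $x\in X$; (ii) for all $y\in X$ the maps $\alpha_y(x)=x\,\overline{\triangleright}\,y$ and $\beta_y(x)=x\,\underline{\triangleright}\,y$ from $X$ to $X$ are invertible, and the map $S:X\times X\to X\times X$, $S(x,y)=(y\,\overline{\triangleright}\,x,\ x\,\underline{\triangleright}\,y)$, is invertible; (iii) for all $x,y,z\in X$, $(x\,\underline{\triangleright}\,y)\,\underline{\triangleright}\,(z\,\underline{\triangleright}\,y)=(x\,\underline{\triangleright}\,z)\,\underline{\triangleright}\,(y\,\overline{\triangleright}\,z)$, $(x\,\underline{\triangleright}\,y)\,\overline{\triangleright}\,(z\,\underline{\triangleright}\,y)=(x\,\overline{\triangleright}\,z)\,\underline{\triangleright}\,(y\,\overline{\triangleright}\,z)$,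 $(x\,\overline{\triangleright}\,y)\,\overline{\triangleright}\,(z\,\overline{\triangleright}\,y)=(x\,\overline{\triangleright}\,z)\,\overline{\triangleright}\,(y\,\underline{\triangleright}\,z)$. **Diagrams and colorings.** Diagrams are oriented. For virtual diagrams "Reidemeister moves" means the classical moves I, II, III together with the usual virtual and mixed moves (equivalently, the detour move). The semiarcs of a diagram are the edges of the directed graph whose vertices are the classical crossings (virtual crossings are not vertices). An $X$-coloring of a diagram assigns an element of $X$ to each semiarc (and to each closed component without classical crossings), with colors unchanged through virtual crossings, such that at each classical crossing there are $x,y\in X$ with the following colors: - positive crossing: the understrand goes from $x$ (incoming) to $x\,\underline{\triangleright}\,y$ (outgoing), and the overstrand goes from $y\,\overline{\triangleright}\,x$ (incoming) to $y$ (outgoing); - negative crossing: the understrand goes from $x\,\underline{\triangleright}\,y$ (incoming) to $x$ (outgoing), and the overstrand goes from $y$ (incoming) to $y\,\overline{\triangleright}\,x$ (outgoing). The set of $X$-colorings of a diagram of $L$ is identified with the biquandle homset $\mathrm{Hom}(\mathcal{B}(L),X)$. For each Reidemeister move, every $X$-coloring before the move corresponds to a unique $X$-coloring after the move agreeing with it outside the neighborhood of the move. **Routes and total fares.** A route of order $2$ is an ordered pair $(s_1,s_2)$ of semiarcs such that the terminal crossing of $s_1$ is the initial crossing of $s_2$; so each classical crossing has four routes of order 2 through it (each of the two incoming semiarcs followed by each of the two outgoing semiarcs). A route is a *through* route if it continues straight along the link (over-to-over or under-to-under) at the crossing, and a *crooked* route if it turns at the crossing (over-to-under or under-to-over). Given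 an $X$-coloring $f$, a route $(s_1,s_2)$ contributes $+\phi(f(s_1),f(s_2))$ if its crossing is positive and $-\phi(f(s_1),f(s_2))$ if its crossing is negative. The total complete (respectively through, crooked) fare $\phi(f)\in A$ is the sum of the contributions of all routes (respectively all through routes, all crooked routes) of order $2$ in the diagram. **The three types of $2$-fare.** For $a,b\in X$ write $T(a,b)=\phi(a,a\,\underline{\triangleright}\,b)+\phi(b\,\overline{\triangleright}\,a,b)$, $T^-(a,b)=\phi(a\,\underline{\triangleright}\,b,a)+\phi(b,b\,\overline{\triangleright}\,a)$, $K(a,b)=\phi(a,b)+\phi(b\,\overline{\triangleright}\,a,a\,\underline{\triangleright}\,b)$, $K^-(a,b)=\phi(b,a)+\phi(a\,\underline{\triangleright}\,b,b\,\overline{\triangleright}\,a)$. A function $\phi:X^2\to A$ is a *through* biquandle $2$-fare if, with $(P,P^-)=(T,T^-)$, a *crooked* biquandle $2$-fare if, with $(P,P^-)=(K,K^-)$, and a *complete* biquandle $2$-fare if, with $(P,P^-)=(T+K,\,T^-+K^-)$, the following hold: (i) for all $x\in X$, $P(x,x)=0$; (ii) for all $x,y\in X$, $P(x,y)-P^-(x,y)=0$; (iii) for all $x,y,z\in X$, $$P(x,y)+P(y,z)+P(x\,\underline{\triangleright}\,y,\ z\,\overline{\triangleright}\,y)=P(x,z)+P(y\,\overline{\triangleright}\,x,\ z\,\overline{\triangleright}\,x)+P(x\,\underline{\triangleright}\,z,\ y\,\underline{\triangleright}\,z).$$ For instance, (i) reads $\phi(x,x\,\underline{\triangleright}\,x)+\phi(x\,\underline{\triangleright}\,x,x)=0$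 for through fares, $\phi(x,x)+\phi(x\,\underline{\triangleright}\,x,x\,\underline{\triangleright}\,x)=0$ for crooked fares, and the sum of these two left-hand sides equal to $0$ for complete fares. *)

theory Defs
  imports Main "HOL-Library.Multiset" "HOL-Library.FuncSet"
begin

section \<open>Biquandles and 2-fares\<close>

locale biquandle =
  fixes X :: "'a set"
    and un :: "'a \<Rightarrow> 'a \<Rightarrow> 'a"  (infixl "\<rhd>\<^sub>u" 70)
    and ov :: "'a \<Rightarrow> 'a \<Rightarrow> 'a"  (infixl "\<rhd>\<^sub>o" 70)
  assumes under_closed: "x \<in> X \<Longrightarrow> y \<in> X \<Longrightarrow> x \<rhd>\<^sub>u y \<in> X"
    and over_closed: "x \<in> X \<Longrightarrow> y \<in> X \<Longrightarrow> x \<rhd>\<^sub>o y \<in> X"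
    and diagonal: "x \<in> X \<Longrightarrow> x \<rhd>\<^sub>u x = x \<rhd>\<^sub>o x"
    and over_invertible: "y \<in> X \<Longrightarrow> bij_betw (\<lambda>x. x \<rhd>\<^sub>o y) X X"
    and under_invertible: "y \<in> X \<Longrightarrow> bij_betw (\<lambda>x. x \<rhd>\<^sub>u y) X X"
    and sideways_invertible: "bij_betw (\<lambda>(x, y). (y \<rhd>\<^sub>o x, x \<rhd>\<^sub>u y)) (X \<times> X) (X \<times> X)"
    and exchange_uu: "x \<in> X \<Longrightarrow> y \<in> X \<Longrightarrow> z \<in> X \<Longrightarrow>
      (x \<rhd>\<^sub>u y) \<rhd>\<^sub>u (z \<rhd>\<^sub>u y) = (x \<rhd>\<^sub>u z) \<rhd>\<^sub>u (y \<rhd>\<^sub>o z)"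
    and exchange_uo: "x \<in> X \<Longrightarrow> y \<in> X \<Longrightarrow> z \<in> X \<Longrightarrow>
      (x \<rhd>\<^sub>u y) \<rhd>\<^sub>o (z \<rhd>\<^sub>u y) = (x \<rhd>\<^sub>o z) \<rhd>\<^sub>u (y \<rhd>\<^sub>o z)"
    and exchange_oo: "x \<in> X \<Longrightarrow> y \<in> X \<Longrightarrow> z \<in> X \<Longrightarrow>
      (x \<rhd>\<^sub>o y) \<rhd>\<^sub>o (z \<rhd>\<^sub>o y) = (x \<rhd>\<^sub>o z) \<rhd>\<^sub>o (y \<rhd>\<^sub>u z)"

datatype fare_type = Complete | Through | Crooked

text \<open>The functions P and \<open>P\<^sup>-\<close> of the three types of 2-fare: T, K, T + K and their versions at
  negative crossings.\<close>

fun positive_weight ::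
  "fare_type \<Rightarrow> ('a \<Rightarrow> 'a \<Rightarrow> 'a) \<Rightarrow> ('a \<Rightarrow> 'a \<Rightarrow> 'a) \<Rightarrow> ('a \<Rightarrow> 'a \<Rightarrow> 'b::ab_group_add) \<Rightarrow> 'a \<Rightarrow> 'a \<Rightarrow> 'b"
  where
    "positive_weight Through un ov \<phi> a b = \<phi> a (un a b) + \<phi> (ov b a) b"
  | "positive_weight Crooked un ov \<phi> a b = \<phi> a b + \<phi> (ov b a) (un a b)"
  | "positive_weight Complete un ov \<phi> a b =
       (\<phi> a (un a b) + \<phi> (ov b a) b) + (\<phi> a b + \<phi> (ov b a) (un a b))"

fun negative_weight ::
  "fare_type \<Rightarrow> ('a \<Rightarrow> 'a \<Rightarrow> 'a) \<Rightarrow> ('a \<Rightarrow> 'a \<Rightarrow> 'a) \<Rightarrow> ('a \<Rightarrow> 'a \<Rightarrow> 'b::ab_group_add) \<Rightarrow> 'a \<Rightarrow> 'a \<Rightarrow> 'b"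
  where
    "negative_weight Through un ov \<phi> a b = \<phi> (un a b) a + \<phi> b (ov b a)"
  | "negative_weight Crooked un ov \<phi> a b = \<phi> b a + \<phi> (un a b) (ov b a)"
  | "negative_weight Complete un ov \<phi> a b =
       (\<phi> (un a b) a + \<phi> b (ov b a)) + (\<phi> b a + \<phi> (un a b) (ov b a))"

definition biquandle_2_fare ::
  "fare_type \<Rightarrow> 'a set \<Rightarrow> ('a \<Rightarrow> 'a \<Rightarrow> 'a) \<Rightarrow> ('a \<Rightarrow> 'a \<Rightarrow> 'a) \<Rightarrow> ('a \<Rightarrow> 'a \<Rightarrow> 'b::ab_group_add) \<Rightarrow> bool"
  where
    "biquandle_2_fare \<tau> X un ov \<phi> \<longleftrightarrow>
      (let P = positive_weight \<tau> un ov \<phi>; N = negative_weight \<tau> un ov \<phi> in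
        (\<forall>x\<in>X. P x x = 0) \<and>
        (\<forall>x\<in>X. \<forall>y\<in>X. P x y - N x y = 0) \<and>
        (\<forall>x\<in>X. \<forall>y\<in>X. \<forall>z\<in>X.
          P x y + P y z + P (un x y) (ov z y) =
          P x z + P (ov y x) (ov z x) + P (un x z) (un y z)))"


section \<open>Oriented classical and virtual link diagrams\<close>

text \<open>
  Diagrams are planar diagram codes: the edges of the 4-valent plane graph are labelled by natural
  numbers, and each crossing, turned so that both of its strands run upwards, lists its edges:
  \<open>sw\<close> and \<open>se\<close> arrive, \<open>nw\<close> and \<open>ne\<close> leave, and the strands are \<open>sw \<rightarrow> ne\<close> and \<open>se \<rightarrow> nw\<close>.
  The overstrand is \<open>sw \<rightarrow> ne\<close> at a positive and \<open>se \<rightarrow> nw\<close> at a negative crossing.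

  \<open>Point a b\<close> is a marked point in the interior of a strand, where edge \<open>a\<close> arrives and edge
  \<open>b\<close> leaves.  Such points have no geometric content; they serve to write down crossingless closed
  components (\<open>Point a a\<close>) and to state local moves with a fixed boundary.
\<close>

datatype kind = Positive | Negative | Virtual

datatype 'e vertex =
    Point 'e 'e
  | Crossing kind 'e 'e 'e 'e

type_synonym diagram = "nat vertex multiset"

fun arriving :: "'e vertex \<Rightarrow> 'e multiset" where
  "arriving (Point a b) = {#a#}"
| "arriving (Crossing k sw se nw ne) = {#sw, se#}"

fun leaving :: "'e vertex \<Rightarrow> 'e multiset" where
  "leaving (Point a b) = {#b#}"
| "leaving (Crossing k sw se nw ne) = {#nw, ne#}"

definition arrivals :: "diagram \<Rightarrow> nat multiset" where
  "arrivals D = (\<Sum>v\<in>#D. arriving v)"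

definition departures :: "diagram \<Rightarrow> nat multiset" where
  "departures D = (\<Sum>v\<in>#D. leaving v)"

definition edges :: "diagram \<Rightarrow> nat set" where
  "edges D = set_mset (arrivals D) \<union> set_mset (departures D)"

text \<open>Every edge leaves exactly one vertex and arrives at exactly one vertex.\<close>

definition well_formed :: "diagram \<Rightarrow> bool" where
  "well_formed D \<longleftrightarrow> (\<forall>e\<in>edges D. count (arrivals D) e = 1 \<and> count (departures D) e = 1)"

text \<open>
  Planarity of the code, by Euler's formula.  A dart \<open>(e, True)\<close> runs along \<open>e\<close>, and
  \<open>(e, False)\<close> runs against it.  \<open>turns v\<close> sends a dart ending at \<open>v\<close> to the next dart on the boundary
  of the face to its left.
\<close>

fun turns :: "'e vertex \<Rightarrow> (('e \<times> bool) \<times> ('e \<times> bool)) set" where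
  "turns (Point a b) = {((a, True), (b, True)), ((b, False), (a, False))}"
| "turns (Crossing k sw se nw ne) =
    {((sw, True), (nw, True)), ((nw, False), (ne, True)),
     ((ne, False), (se, False)), ((se, True), (sw, False))}"

fun incidences :: "'e vertex \<Rightarrow> ('e \<times> 'e) set" where
  "incidences v = set_mset (arriving v + leaving v) \<times> set_mset (arriving v + leaving v)"

definition faces :: "diagram \<Rightarrow> (nat \<times> bool) set set" where
  "faces D = (let R = (\<Union>v\<in>set_mset D. turns v) in (edges D \<times> UNIV) // (R \<union> R\<inverse>)\<^sup>*)"

definition graph_components :: "diagram \<Rightarrow> nat set set" where
  "graph_components D = edges D // (\<Union>v\<in>set_mset D. incidences v)\<^sup>*"

text \<open>
  The Euler characteristics of the graph components add up to at most twice their number, with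
  equality exactly if each of them embeds in the sphere with the given cyclic orders.
  The relative position of disjoint graph components is not recorded; colorings and fares do not
  depend on it.
\<close>

definition planar :: "diagram \<Rightarrow> bool" where
  "planar D \<longleftrightarrow> size D + card (faces D) = card (edges D) + 2 * card (graph_components D)"

definition link_diagram :: "diagram \<Rightarrow> bool" where
  "link_diagram D \<longleftrightarrow> well_formed D \<and> planar D"


section \<open>Reidemeister moves\<close>

fun opposite :: "kind \<Rightarrow> kind" where
  "opposite Positive = Negative"
| "opposite Negative = Positive"
| "opposite Virtual = Virtual"

text \<open>
  \<open>triangle_kinds k12 k13 k23\<close>: the crossings of three strands 1, 2, 3 that may occur in a move of
  type III.  Here \<open>kij\<close> is the kind of the crossing of strands \<open>i\<close> and \<open>j\<close> if strand \<open>i\<close> is the one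
  running from \<open>sw\<close> to \<open>ne\<close>, so \<open>kij = Positive\<close> says that strand \<open>i\<close> is over strand \<open>j\<close>.  The
  classical move has three strands at distinct heights; in the virtual and mixed moves one of the
  strands is detoured and has only virtual crossings.  The forbidden moves, with one virtual and two
  classical crossings, are absent.
\<close>

inductive triangle_kinds :: "kind \<Rightarrow> kind \<Rightarrow> kind \<Rightarrow> bool" where
  classical: "distinct [h1, h2, h3 :: nat] \<Longrightarrow>
    triangle_kinds (if h1 > h2 then Positive else Negative)
                   (if h1 > h3 then Positive else Negative)
                   (if h2 > h3 then Positive else Negative)"
| detour1: "triangle_kinds Virtual Virtual k"
| detour2: "triangle_kinds Virtual k Virtual"
| detour3: "triangle_kinds k Virtual Virtual"

text \<open>
  The tangles before and after a move.  Boundary edges are \<open>a, b, c\<close> (entering) and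
  \<open>a', b', c'\<close> (leaving); \<open>p, q, r, p', q', r'\<close> are internal.  With \<open>k\<close> virtual these are
  the virtual moves.

  In a braid-like triangle all three strands run upwards; every non-cyclically oriented triangle can
  be turned into this position.  In a cyclic triangle the internal edges form a directed cycle,
  counterclockwise before and clockwise after the move.
\<close>

inductive local_move :: "diagram \<Rightarrow> diagram \<Rightarrow> bool" where
  R1_left: "local_move {#Point a a'#} {#Crossing k p a p a'#}"
| R1_right: "local_move {#Point a a'#} {#Crossing k a p a' p#}"
| R2_parallel: "local_move {#Point a a', Point b b'#}
    {#Crossing k a b p q, Crossing (opposite k) p q a' b'#}"
| R2_antiparallel_right: "local_move {#Point a a', Point b b'#}
    {#Crossing k a q b' p, Crossing (opposite k) b p a' q#}"
| R2_antiparallel_left: "local_move {#Point a a', Point b b'#}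
    {#Crossing k q a p b', Crossing (opposite k) p b q a'#}"
| R3_braid: "triangle_kinds k12 k13 k23 \<Longrightarrow> local_move
    {#Crossing k12 a b p q, Crossing k13 q c r a', Crossing k23 p r c' b'#}
    {#Crossing k23 b c p' q', Crossing k13 a p' c' r', Crossing k12 r' q' b' a'#}"
| R3_cyclic: "triangle_kinds k12 k13 k23 \<Longrightarrow> local_move
    {#Crossing k12 p b q a', Crossing k23 q c r b', Crossing (opposite k13) r a p c'#}
    {#Crossing k12 a q' b' p', Crossing k23 b r' c' q', Crossing (opposite k13) c p' a' r'#}"

text \<open>Besides the local moves there are the changes of the code that leave the drawn diagram as it
  is: renaming edges, and removing a marked point (reversed: subdividing an edge).\<close>

inductive reidemeister_move :: "diagram \<Rightarrow> diagram \<Rightarrow> bool" where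
  rename: "link_diagram D \<Longrightarrow> inj_on \<pi> (edges D) \<Longrightarrow>
    reidemeister_move D (image_mset (map_vertex \<pi>) D)"
| unmark: "link_diagram (add_mset (Point a b) C) \<Longrightarrow> a \<noteq> b \<Longrightarrow>
    reidemeister_move (add_mset (Point a b) C) (image_mset (map_vertex (id(b := a))) C)"
| local: "local_move T T' \<Longrightarrow> link_diagram (C + T) \<Longrightarrow> link_diagram (C + T') \<Longrightarrow>
    reidemeister_move (C + T) (C + T')"

definition reidemeister_equivalent :: "diagram \<Rightarrow> diagram \<Rightarrow> bool" where
  "reidemeister_equivalent = equivclp reidemeister_move"


section \<open>Colorings and fares\<close>

text \<open>
  A semiarc is a maximal chain of edges joined at virtual crossings and marked points.  A function on
  semiarcs is given as a function on edges that is unchanged there.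
\<close>

fun colored_at ::
  "'a set \<Rightarrow> ('a \<Rightarrow> 'a \<Rightarrow> 'a) \<Rightarrow> ('a \<Rightarrow> 'a \<Rightarrow> 'a) \<Rightarrow> ('e \<Rightarrow> 'a) \<Rightarrow> 'e vertex \<Rightarrow> bool"
  where
    "colored_at X un ov f (Point a b) \<longleftrightarrow> f a = f b"
  | "colored_at X un ov f (Crossing Virtual sw se nw ne) \<longleftrightarrow> f sw = f ne \<and> f se = f nw"
  | "colored_at X un ov f (Crossing Positive sw se nw ne) \<longleftrightarrow>
      (\<exists>x\<in>X. \<exists>y\<in>X. f se = x \<and> f nw = un x y \<and> f sw = ov y x \<and> f ne = y)"
  | "colored_at X un ov f (Crossing Negative sw se nw ne) \<longleftrightarrow>
      (\<exists>x\<in>X. \<exists>y\<in>X. f sw = un x y \<and> f ne = x \<and> f se = y \<and> f nw = ov y x)"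

definition colorings ::
  "'a set \<Rightarrow> ('a \<Rightarrow> 'a \<Rightarrow> 'a) \<Rightarrow> ('a \<Rightarrow> 'a \<Rightarrow> 'a) \<Rightarrow> diagram \<Rightarrow> (nat \<Rightarrow> 'a) set"
  where
    "colorings X un ov D = {f \<in> edges D \<rightarrow>\<^sub>E X. \<forall>v\<in>#D. colored_at X un ov f v}"

text \<open>
  The routes of order 2 through a vertex.  A route of semiarcs is represented by the last edge of the
  first and the first edge of the second semiarc.
\<close>

fun routes :: "fare_type \<Rightarrow> 'e vertex \<Rightarrow> ('e \<times> 'e) list" where
  "routes \<tau> (Point a b) = []"
| "routes \<tau> (Crossing Virtual sw se nw ne) = []"
| "routes Through (Crossing k sw se nw ne) = [(sw, ne), (se, nw)]"
| "routes Crooked (Crossing k sw se nw ne) = [(sw, nw), (se, ne)]"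
| "routes Complete (Crossing k sw se nw ne) = [(sw, ne), (se, nw), (sw, nw), (se, ne)]"

fun signed :: "'e vertex \<Rightarrow> 'b::ab_group_add \<Rightarrow> 'b" where
  "signed (Crossing Negative sw se nw ne) z = - z"
| "signed v z = z"

definition total_fare ::
  "fare_type \<Rightarrow> ('a \<Rightarrow> 'a \<Rightarrow> 'b::ab_group_add) \<Rightarrow> (nat \<Rightarrow> 'a) \<Rightarrow> diagram \<Rightarrow> 'b"
  where
    "total_fare \<tau> \<phi> f D = (\<Sum>v\<in>#D. \<Sum>(s, t)\<leftarrow>routes \<tau> v. signed v (\<phi> (f s) (f t)))"

end

theory Submission
  imports Defs
begin

text \<open>
  Each move only has to be compared near the place where it happens.  A coloring of a tangle by
  elements of \<open>X\<close> is determined by its values on the boundary edges; if each coloring of one side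
  of a move has a counterpart on the other side with the same boundary values and the same fare,
  then restriction to the edges outside the move matches up the colorings of the two diagrams.  By
  condition (ii) of a fare the contribution of a negative crossing is minus that of the positive
  crossing obtained by turning it upside down, which settles type II; type I is condition (i), and
  all versions of type III reduce to condition (iii) on the cube spanned by three elements of \<open>X\<close>.
\<close>

section \<open>Diagrams\<close>

text \<open>A classical crossing is treated as a square \<open>sideways x y s t\<close>, that is
  S(x,y) = (s,t). Invertibility of alpha, beta and S says that the two colors on any one of its four
  sides can be prescribed and determine the other two. Positive and negative crossings are the same
  square turned upside down, so signs and orientations only change which side is given. This is why
  one cube serves all six height orders of both kinds of triangle: the exchange laws close the cube,
  condition (iii) equates the weights at one pair of antipodal corners, and for the other pairs
  terms move across the equation, which produces the signs of the negative crossings.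

  Two obstacles remain. Boundary edges of a move may coincide and need not occur outside it, as when
  a crossingless circle receives a kink; so only internal edges are shown to differ from the others.
  And a kink on the left gives a square with s = t, from which x = y has to be recovered; here
  finiteness of X is used.\<close>

abbreviation ends :: "'e vertex \<Rightarrow> 'e set" where
  "ends v \<equiv> set_mset (arriving v) \<union> set_mset (leaving v)"

lemma arrivals_simps [simp]:
  "arrivals {#} = {#}"
  "arrivals (add_mset v D) = arriving v + arrivals D"
  "arrivals (C + D) = arrivals C + arrivals D"
  by (simp_all add: arrivals_def)

lemma departures_simps [simp]:
  "departures {#} = {#}"
  "departures (add_mset v D) = leaving v + departures D"
  "departures (C + D) = departures C + departures D"
  by (simp_all add: departures_def)

lemma edges_simps [simp]:
  "edges {#} = {}"
  "edges (add_mset v D) = ends v \<union> edges D"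
  "edges (C + D) = edges C \<union> edges D"
  by (auto simp: edges_def)

lemma ends_subset_edges: "v \<in># D \<Longrightarrow> ends v \<subseteq> edges D"
  by (auto dest!: multi_member_split)

lemma edges_eq_UN: "edges D = (\<Union>v\<in>set_mset D. ends v)"
  by (induction D) auto

lemma ends_map_vertex: "ends (map_vertex \<sigma> v) = \<sigma> ` ends v"
  by (cases v) auto

lemma edges_image_map_vertex: "edges (image_mset (map_vertex \<sigma>) D) = \<sigma> ` edges D"
  by (simp only: edges_eq_UN set_image_mset image_UN UN_simps ends_map_vertex)

lemma well_formed_count_le:
  assumes "well_formed D"
  shows "count (arrivals D) e \<le> 1" "count (departures D) e \<le> 1"
proof -
  have "count (arrivals D) e \<le> 1 \<and> count (departures D) e \<le> 1"
  proof (cases "e \<in> edges D")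
    case True
    then show ?thesis using assms by (simp add: well_formed_def)
  next
    case False
    then show ?thesis by (simp add: edges_def not_in_iff)
  qed
  then show "count (arrivals D) e \<le> 1" "count (departures D) e \<le> 1" by auto
qed

lemma well_formed_distinct_arrivals:
  assumes "well_formed (C + T)" and "arrivals T = mset es"
  shows "distinct es"
proof -
  have "count (mset es) e \<le> 1" for e
    using well_formed_count_le(1)[OF assms(1), of e] assms(2) by simp
  then show ?thesis
    by (metis count_eq_zero_iff distinct_count_atmost_1 le_antisym less_one linorder_le_less_linear
        set_mset_mset)
qed

lemma well_formed_distinct_departures:
  assumes "well_formed (C + T)" and "departures T = mset es"
  shows "distinct es"
proof -
  have "count (mset es) e \<le> 1" for e
    using well_formed_count_le(2)[OF assms(1), of e] assms(2) by simp
  then show ?thesis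
    by (metis count_eq_zero_iff distinct_count_atmost_1 le_antisym less_one linorder_le_less_linear
        set_mset_mset)
qed

text \<open>An edge has one arrival and one departure in all; if \<open>T\<close> uses up both, an
  occurrence in \<open>C\<close> would be a second one.\<close>

lemma well_formed_internal_edge:
  assumes "well_formed (C + T)" and "e \<in># arrivals T" and "e \<in># departures T"
  shows "e \<notin> edges C"
proof
  assume "e \<in> edges C"
  then have "2 \<le> count (arrivals (C + T)) e \<or> 2 \<le> count (departures (C + T)) e"
    using assms(2,3) unfolding edges_def
    by (auto simp flip: count_greater_zero_iff)
  then show False
    using well_formed_count_le[OF assms(1), of e] by linarith
qed

lemma vertex_cases:
  obtains (Point) a b where "v = Point a b"
  | (Positive) sw se nw ne where "v = Crossing Positive sw se nw ne"
  | (Negative) sw se nw ne where "v = Crossing Negative sw se nw ne"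
  | (Virtual) sw se nw ne where "v = Crossing Virtual sw se nw ne"
  by (metis kind.exhaust vertex.exhaust)

section \<open>Fares and colorings vertex by vertex\<close>

lemma routes_subset_ends: "(s, t) \<in> set (routes \<tau> v) \<Longrightarrow> s \<in> ends v \<and> t \<in> ends v"
  by (cases v rule: vertex_cases; cases \<tau>) auto

lemma total_fare_add_mset:
  "total_fare \<tau> \<phi> f (add_mset v D) =
    (\<Sum>(s, t)\<leftarrow>routes \<tau> v. signed v (\<phi> (f s) (f t))) + total_fare \<tau> \<phi> f D"
  by (simp add: total_fare_def)

lemma total_fare_simps [simp]:
  "total_fare \<tau> \<phi> f {#} = 0"
  "total_fare \<tau> \<phi> f (add_mset (Point a b) D) = total_fare \<tau> \<phi> f D"
  "total_fare \<tau> \<phi> f (C + D) = total_fare \<tau> \<phi> f C + total_fare \<tau> \<phi> f D"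
  by (simp_all add: total_fare_def)

lemma total_fare_cong:
  assumes "\<And>e. e \<in> edges D \<Longrightarrow> f e = g e"
  shows "total_fare \<tau> \<phi> f D = total_fare \<tau> \<phi> g D"
  using assms
proof (induction D)
  case (add v D)
  have "map (\<lambda>(s, t). signed v (\<phi> (f s) (f t))) (routes \<tau> v) =
        map (\<lambda>(s, t). signed v (\<phi> (g s) (g t))) (routes \<tau> v)"
    using add.prems by (auto dest!: routes_subset_ends)
  then have "(\<Sum>(s, t)\<leftarrow>routes \<tau> v. signed v (\<phi> (f s) (f t))) =
             (\<Sum>(s, t)\<leftarrow>routes \<tau> v. signed v (\<phi> (g s) (g t)))"
    by (rule arg_cong)
  then show ?case using add by (simp add: total_fare_add_mset)
qed simp

lemma total_fare_map_vertex:
  "total_fare \<tau> \<phi> f (image_mset (map_vertex \<sigma>) D) = total_fare \<tau> \<phi> (f \<circ> \<sigma>) D"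
proof (induction D)
  case (add v D)
  have "(\<Sum>(s, t)\<leftarrow>routes \<tau> (map_vertex \<sigma> v). signed (map_vertex \<sigma> v) (\<phi> (f s) (f t))) =
        (\<Sum>(s, t)\<leftarrow>routes \<tau> v. signed v (\<phi> ((f \<circ> \<sigma>) s) ((f \<circ> \<sigma>) t)))"
    by (cases v rule: vertex_cases; cases \<tau>) simp_all
  then show ?case using add by (simp add: total_fare_add_mset)
qed simp

text \<open>Both sets are compared inside a common target of \<open>\<rho>\<close> and
  \<open>\<rho>'\<close>. Injectivity makes counterparts unique, so the last assumption need not
  mention \<open>F\<close>: the element it provides already has a counterpart with equal value, and
  that can only be \<open>f'\<close>.\<close>

lemma image_mset_mset_set_eqI:
  assumes inj: "inj_on \<rho> S" "inj_on \<rho>' S'"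
    and "\<And>f. f \<in> S \<Longrightarrow> \<exists>f'\<in>S'. \<rho>' f' = \<rho> f \<and> F' f' = F f"
    and "\<And>f'. f' \<in> S' \<Longrightarrow> \<exists>f\<in>S. \<rho> f = \<rho>' f'"
  shows "image_mset F (mset_set S) = image_mset F' (mset_set S')"
proof -
  define g where "g = (\<lambda>f. inv_into S' \<rho>' (\<rho> f))"
  have g: "g f \<in> S' \<and> \<rho>' (g f) = \<rho> f \<and> F' (g f) = F f" if "f \<in> S" for f
    using assms(3)[OF that] inj(2) unfolding g_def by (metis inv_into_f_f)
  have "inj_on g S"
    using g inj(1) by (metis inj_on_def)
  moreover have "g ` S = S'"
    using g assms(4) inj(2) by (auto simp: image_iff) (metis inj_on_def)
  ultimately have "mset_set S' = image_mset g (mset_set S)"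
    by (simp add: image_mset_mset_set)
  moreover have "image_mset F (mset_set S) = image_mset (F' \<circ> g) (mset_set S)"
    using g by (cases "finite S") (auto intro!: image_mset_cong)
  ultimately show ?thesis
    by (simp add: multiset.map_comp)
qed

lemma colored_at_cong:
  assumes "\<And>e. e \<in> ends v \<Longrightarrow> f e = g e"
  shows "colored_at X un ov f v \<longleftrightarrow> colored_at X un ov g v"
  using assms by (cases v rule: vertex_cases) simp_all

lemma colored_at_map_vertex:
  "colored_at X un ov f (map_vertex \<sigma> v) \<longleftrightarrow> colored_at X un ov (f \<circ> \<sigma>) v"
  by (cases v rule: vertex_cases) simp_all


section \<open>Colored crossings\<close>

locale fare_biquandle = biquandle X un ov
  for X :: "'a set" and un ov +
  fixes \<tau> :: fare_type and \<phi> :: "'a \<Rightarrow> 'a \<Rightarrow> 'b::ab_group_add"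
  assumes finite_X: "finite X"
    and fare: "biquandle_2_fare \<tau> X un ov \<phi>"
begin

notation un (infixl "\<rhd>\<^sub>u" 70)
notation ov (infixl "\<rhd>\<^sub>o" 70)

abbreviation P :: "'a \<Rightarrow> 'a \<Rightarrow> 'b" where
  "P \<equiv> positive_weight \<tau> un ov \<phi>"

lemma P_diagonal: "x \<in> X \<Longrightarrow> P x x = 0"
  using fare by (simp add: biquandle_2_fare_def Let_def)

lemma negative_weight_eq: "x \<in> X \<Longrightarrow> y \<in> X \<Longrightarrow> negative_weight \<tau> un ov \<phi> x y = P x y"
  using fare by (simp add: biquandle_2_fare_def Let_def)

lemma P_cocycle:
  assumes "x \<in> X" "y \<in> X" "z \<in> X"
  shows "P x y + P y z + P (x \<rhd>\<^sub>u y) (z \<rhd>\<^sub>o y) =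
         P x z + P (y \<rhd>\<^sub>o x) (z \<rhd>\<^sub>o x) + P (x \<rhd>\<^sub>u z) (y \<rhd>\<^sub>u z)"
  using fare assms unfolding biquandle_2_fare_def Let_def by blast

text \<open>The graph of S, kept as a relation so that it can be read from any side. At a positive
  crossing \<open>x\<close>, \<open>y\<close> lie on the right, \<open>s\<close>, \<open>t\<close>
  on the left, \<open>x\<close>, \<open>s\<close> at the bottom and \<open>y\<close>,
  \<open>t\<close> at the top; a negative crossing exchanges bottom and top.\<close>

definition sideways :: "'a \<Rightarrow> 'a \<Rightarrow> 'a \<Rightarrow> 'a \<Rightarrow> bool" where
  "sideways x y s t \<longleftrightarrow> x \<in> X \<and> y \<in> X \<and> s = y \<rhd>\<^sub>o x \<and> t = x \<rhd>\<^sub>u y"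

lemma sidewaysI: "x \<in> X \<Longrightarrow> y \<in> X \<Longrightarrow> sideways x y (y \<rhd>\<^sub>o x) (x \<rhd>\<^sub>u y)"
  by (simp add: sideways_def)

lemma sideways_closed:
  "sideways x y s t \<Longrightarrow> x \<in> X" "sideways x y s t \<Longrightarrow> y \<in> X"
  "sideways x y s t \<Longrightarrow> s \<in> X" "sideways x y s t \<Longrightarrow> t \<in> X"
  by (auto simp: sideways_def under_closed over_closed)

lemma sideways_unique_xy:
  "sideways x y s t \<Longrightarrow> sideways x y s' t' \<Longrightarrow> s = s' \<and> t = t'"
  by (simp add: sideways_def)

lemma sideways_unique_st:
  assumes "sideways x y s t" "sideways x' y' s t"
  shows "x = x' \<and> y = y'"
proof -
  have "inj_on (\<lambda>(x, y). (y \<rhd>\<^sub>o x, x \<rhd>\<^sub>u y)) (X \<times> X)"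
    using sideways_invertible by (simp add: bij_betw_def)
  then show ?thesis using assms unfolding sideways_def inj_on_def by auto
qed

lemma sideways_unique_xs:
  "sideways x y s t \<Longrightarrow> sideways x y' s t' \<Longrightarrow> y = y' \<and> t = t'"
  using over_invertible[of x] unfolding sideways_def bij_betw_def inj_on_def by auto

lemma sideways_unique_yt:
  "sideways x y s t \<Longrightarrow> sideways x' y s' t \<Longrightarrow> x = x' \<and> s = s'"
  using under_invertible[of y] unfolding sideways_def bij_betw_def inj_on_def by auto

lemma sideways_exists_st:
  assumes "s \<in> X" "t \<in> X"
  obtains x y where "sideways x y s t"
proof -
  have "(s, t) \<in> (\<lambda>(x, y). (y \<rhd>\<^sub>o x, x \<rhd>\<^sub>u y)) ` (X \<times> X)"
    using sideways_invertible assms by (simp add: bij_betw_def)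
  then show ?thesis using that by (auto simp: sideways_def)
qed

lemma sideways_exists_xs:
  assumes "x \<in> X" "s \<in> X"
  obtains y t where "sideways x y s t"
proof -
  have "s \<in> (\<lambda>y. y \<rhd>\<^sub>o x) ` X"
    using over_invertible[OF assms(1)] assms by (simp add: bij_betw_def)
  then show ?thesis using that assms by (auto simp: sideways_def)
qed

lemma sideways_exists_yt:
  assumes "y \<in> X" "t \<in> X"
  obtains x s where "sideways x y s t"
proof -
  have "t \<in> (\<lambda>x. x \<rhd>\<^sub>u y) ` X"
    using under_invertible[OF assms(1)] assms by (simp add: bij_betw_def)
  then show ?thesis using that assms by (auto simp: sideways_def)
qed

lemma sideways_diagonal: "x \<in> X \<Longrightarrow> sideways x x (x \<rhd>\<^sub>u x) (x \<rhd>\<^sub>u x)"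
  by (simp add: sideways_def diagonal)

text \<open>S sends (x,x) to a diagonal pair by axiom (i), so injectivity is inherited from S;
  finiteness of X then gives surjectivity.\<close>

lemma bij_diagonal: "bij_betw (\<lambda>x. x \<rhd>\<^sub>u x) X X"
proof -
  have "inj_on (\<lambda>x. x \<rhd>\<^sub>u x) X"
  proof (rule inj_onI)
    fix x y assume "x \<in> X" "y \<in> X" "x \<rhd>\<^sub>u x = y \<rhd>\<^sub>u y"
    then show "x = y"
      using sideways_unique_st[OF sideways_diagonal[of x], of y y] sideways_diagonal[of y] by simp
  qed
  moreover from this have "(\<lambda>x. x \<rhd>\<^sub>u x) ` X = X"
    using finite_X by (intro endo_inj_surj) (auto simp: under_closed)
  ultimately show ?thesis by (simp add: bij_betw_def)
qed

text \<open>By finiteness the injective map \<open>S\<close> permutes the diagonal, so nothing else is sent there.\<close>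

lemma sideways_eqD:
  assumes "sideways x y s s"
  shows "x = y"
proof -
  have "s \<in> (\<lambda>x. x \<rhd>\<^sub>u x) ` X"
    using bij_diagonal sideways_closed(3)[OF assms] by (simp add: bij_betw_def)
  then obtain w where "w \<in> X" "s = w \<rhd>\<^sub>u w" by auto
  then show ?thesis using sideways_diagonal[of w] sideways_unique_st[OF assms] by auto
qed

section \<open>Crossings of all three kinds as squares\<close>

fun admissible :: "kind \<Rightarrow> 'a \<Rightarrow> 'a \<Rightarrow> 'a \<Rightarrow> 'a \<Rightarrow> bool" where
  "admissible Positive sw se nw ne \<longleftrightarrow> sideways se ne sw nw"
| "admissible Negative sw se nw ne \<longleftrightarrow> sideways ne se nw sw"
| "admissible Virtual sw se nw ne \<longleftrightarrow> sw \<in> X \<and> se \<in> X \<and> sw = ne \<and> se = nw"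

text \<open>The negative case uses \<open>P\<close> instead of the negative weight, anticipating
  condition (ii); both signs then obey the same cube equation.\<close>

fun weight :: "kind \<Rightarrow> 'a \<Rightarrow> 'a \<Rightarrow> 'a \<Rightarrow> 'a \<Rightarrow> 'b" where
  "weight Positive sw se nw ne = P se ne"
| "weight Negative sw se nw ne = - P ne se"
| "weight Virtual sw se nw ne = 0"

lemma admissible_closed:
  assumes "admissible k sw se nw ne"
  shows "sw \<in> X" "se \<in> X" "nw \<in> X" "ne \<in> X"
  using assms sideways_closed[of se ne sw nw] sideways_closed[of ne se nw sw] by (cases k; auto)+

lemma admissible_opposite [simp]:
  "admissible (opposite k) sw se nw ne \<longleftrightarrow> admissible k nw ne sw se"
  by (cases k) auto

lemma weight_opposite [simp]: "weight (opposite k) sw se nw ne = - weight k nw ne sw se"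
  by (cases k) auto

text \<open>The suffix here and below names the side that the opposite side determines. Top and
  bottom rest on alpha and beta being injective, left on S being a function, right on S being
  injective.\<close>

lemma admissible_unique_top:
  "admissible k a b p q \<Longrightarrow> admissible k a b p' q' \<Longrightarrow> p = p' \<and> q = q'"
  by (cases k) (auto dest: sideways_unique_xs sideways_unique_yt)

lemma admissible_unique_bottom:
  "admissible k p q a b \<Longrightarrow> admissible k p' q' a b \<Longrightarrow> p = p' \<and> q = q'"
  by (cases k) (auto dest: sideways_unique_xs sideways_unique_yt)

lemma admissible_unique_left:
  "admissible k p a q b \<Longrightarrow> admissible k p' a q' b \<Longrightarrow> p = p' \<and> q = q'"
  by (cases k) (auto dest: sideways_unique_xy)

lemma admissible_unique_right:
  "admissible k a p b q \<Longrightarrow> admissible k a p' b q' \<Longrightarrow> p = p' \<and> q = q'"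
  by (cases k) (auto dest: sideways_unique_st)

lemma admissible_exists_top:
  assumes "a \<in> X" "b \<in> X"
  obtains p q where "admissible k a b p q"
proof (cases k)
  case Positive
  then show ?thesis using that assms by (auto elim: sideways_exists_xs[of b a])
next
  case Negative
  then show ?thesis using that assms by (auto elim: sideways_exists_yt[of b a])
qed (use that assms in auto)

lemma admissible_exists_left:
  assumes "a \<in> X" "b \<in> X"
  obtains p q where "admissible k p a q b"
proof (cases k)
  case Positive
  then show ?thesis using that sidewaysI[of a b] assms by simp
next
  case Negative
  then show ?thesis using that sidewaysI[of b a] assms by simp
qed (use that assms in auto)

lemma admissible_exists_right:
  assumes "a \<in> X" "b \<in> X"
  obtains p q where "admissible k a p b q"
proof (cases k)
  case Positive
  then show ?thesis using that assms by (auto elim: sideways_exists_st[of a b])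
next
  case Negative
  then show ?thesis using that assms by (auto elim: sideways_exists_st[of b a])
qed (use that assms in auto)

text \<open>The kink closes up on the left, so its square has s = t; \<open>sideways_eqD\<close>
  puts it on the diagonal, where \<open>P\<close> vanishes by condition (i).\<close>

lemma admissible_left_loop:
  assumes "admissible k p a p b"
  shows "a = b" "weight k p a p b = 0"
  using assms sideways_eqD[of a b p] sideways_eqD[of b a p] admissible_closed(2,4)[OF assms]
  by (cases k; simp add: P_diagonal)+

lemma admissible_left_loop_exists:
  assumes "a \<in> X"
  obtains p where "admissible k p a p a"
proof
  let ?p = "if k = Virtual then a else a \<rhd>\<^sub>u a"
  show "admissible k ?p a ?p a"
    using assms by (cases k) (simp_all add: sideways_diagonal)
qed

lemma admissible_right_loop:
  assumes "admissible k a p b p"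
  shows "a = b" "weight k a p b p = 0"
  using assms sideways_unique_xy[OF sideways_diagonal, of p] admissible_closed(2)[OF assms]
  by (cases k; auto simp: P_diagonal)+

text \<open>Here the loop carries x = y while \<open>a\<close> is the common value of s and t, so
  its color is the preimage of \<open>a\<close> under the diagonal map.\<close>

lemma admissible_right_loop_exists:
  assumes "a \<in> X"
  obtains p where "admissible k a p a p"
proof -
  have "a \<in> (\<lambda>x. x \<rhd>\<^sub>u x) ` X"
    using bij_diagonal assms by (simp add: bij_betw_def)
  then obtain p where "p \<in> X" "a = p \<rhd>\<^sub>u p" by auto
  then have "admissible k a (if k = Virtual then a else p) a (if k = Virtual then a else p)"
    using assms by (cases k) (simp_all add: sideways_diagonal)
  then show ?thesis by (rule that)
qed

subsection \<open>The third Reidemeister move on colors\<close>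

text \<open>
  A coloring of a triangle before and after a move of type III amounts to a cube whose faces are
  \<open>sideways\<close> squares: opposite faces are the two copies of one crossing, and the two sides of the
  move are the faces at two antipodal corners.  A sign choice or orientation of the move selects one
  of the four pairs of antipodal corners.  Three faces at any corner determine the whole cube; the
  corner is encoded below by listing which copy of the crossings \<open>xy\<close>, \<open>yz\<close>, \<open>xz\<close> it contains.
\<close>

definition cube :: "'a \<Rightarrow> 'a \<Rightarrow> 'a \<Rightarrow> 'a \<Rightarrow> 'a \<Rightarrow> 'a \<Rightarrow> 'a \<Rightarrow> 'a \<Rightarrow> 'a \<Rightarrow> 'a \<Rightarrow> 'a \<Rightarrow> 'a \<Rightarrow> bool" where
  "cube x y z y1 x2 z1 x3 z2 y3 A B C \<longleftrightarrow>
    sideways x y y1 x2 \<and> sideways y z z2 y3 \<and> sideways x z z1 x3 \<and>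
    sideways x3 y3 B C \<and> sideways y1 z1 A B \<and> sideways x2 z2 A C \<and>
    P x y + P y z + P x2 z2 = P x z + P y1 z1 + P x3 y3"

text \<open>The three upper faces prescribe each of \<open>A\<close>, \<open>B\<close>,
  \<open>C\<close> twice. The two values agree by one exchange law each: \<open>exchange_oo\<close>
  for \<open>A\<close>, \<open>exchange_uo\<close> for \<open>B\<close>, \<open>exchange_uu\<close>
  for \<open>C\<close>. The weight equation is condition (iii).\<close>

lemma cube_exists:
  assumes "x \<in> X" "y \<in> X" "z \<in> X"
  obtains y1 x2 z1 x3 z2 y3 A B C where "cube x y z y1 x2 z1 x3 z2 y3 A B C"
proof -
  have "cube x y z (y \<rhd>\<^sub>o x) (x \<rhd>\<^sub>u y) (z \<rhd>\<^sub>o x) (x \<rhd>\<^sub>u z) (z \<rhd>\<^sub>o y) (y \<rhd>\<^sub>u z)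
    ((z \<rhd>\<^sub>o x) \<rhd>\<^sub>o (y \<rhd>\<^sub>o x)) ((y \<rhd>\<^sub>u z) \<rhd>\<^sub>o (x \<rhd>\<^sub>u z)) ((x \<rhd>\<^sub>u z) \<rhd>\<^sub>u (y \<rhd>\<^sub>u z))"
    using P_cocycle[OF assms] assms
      exchange_oo[of z x y] exchange_uo[of y z x] exchange_uu[of x z y]
    by (simp add: cube_def sideways_def under_closed over_closed)
  then show ?thesis by (rule that)
qed

text \<open>With at most one high face, \<open>x\<close>, \<open>y\<close>, \<open>z\<close> are
  among the given colors. The cube on them exists, and since S is a function its faces must be the
  given ones.\<close>

lemma cube_lll:
  assumes "sideways x y y1 x2" "sideways y z z2 y3" "sideways x z z1 x3"
  obtains A B C where "cube x y z y1 x2 z1 x3 z2 y3 A B C"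
proof -
  obtain y1' x2' z1' x3' z2' y3' A B C where c: "cube x y z y1' x2' z1' x3' z2' y3' A B C"
    using assms cube_exists sideways_closed by metis
  then have "y1' = y1" "x2' = x2" "z2' = z2" "y3' = y3" "z1' = z1" "x3' = x3"
    using assms unfolding cube_def by (auto dest: sideways_unique_xy)
  with c show ?thesis using that by simp
qed

lemma cube_hll:
  assumes "sideways x3 y3 B C" "sideways y z z2 y3" "sideways x z z1 x3"
  obtains y1 x2 A where "cube x y z y1 x2 z1 x3 z2 y3 A B C"
proof -
  obtain y1 x2 z1' x3' z2' y3' A B' C' where c: "cube x y z y1 x2 z1' x3' z2' y3' A B' C'"
    using assms cube_exists sideways_closed by metis
  then have "z2' = z2" "y3' = y3" "z1' = z1" "x3' = x3"
    using assms unfolding cube_def by (auto dest: sideways_unique_xy)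
  moreover from this c have "B' = B" "C' = C"
    using assms unfolding cube_def by (auto dest: sideways_unique_xy)
  ultimately show ?thesis using c that by simp
qed

lemma cube_lhl:
  assumes "sideways x y y1 x2" "sideways y1 z1 A B" "sideways x z z1 x3"
  obtains z2 y3 C where "cube x y z y1 x2 z1 x3 z2 y3 A B C"
proof -
  obtain y1' x2' z1' x3' z2 y3 A' B' C where c: "cube x y z y1' x2' z1' x3' z2 y3 A' B' C"
    using assms cube_exists sideways_closed by metis
  then have "y1' = y1" "x2' = x2" "z1' = z1" "x3' = x3"
    using assms unfolding cube_def by (auto dest: sideways_unique_xy)
  moreover from this c have "A' = A" "B' = B"
    using assms unfolding cube_def by (auto dest: sideways_unique_xy)
  ultimately show ?thesis using c that by simp
qed

lemma cube_llh:
  assumes "sideways x y y1 x2" "sideways y z z2 y3" "sideways x2 z2 A C"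
  obtains z1 x3 B where "cube x y z y1 x2 z1 x3 z2 y3 A B C"
proof -
  obtain y1' x2' z1 x3 z2' y3' A' B C' where c: "cube x y z y1' x2' z1 x3 z2' y3' A' B C'"
    using assms cube_exists sideways_closed by metis
  then have "y1' = y1" "x2' = x2" "z2' = z2" "y3' = y3"
    using assms unfolding cube_def by (auto dest: sideways_unique_xy)
  moreover from this c have "A' = A" "C' = C"
    using assms unfolding cube_def by (auto dest: sideways_unique_xy)
  ultimately show ?thesis using c that by simp
qed

text \<open>From two high faces on, part of \<open>x\<close>, \<open>y\<close>, \<open>z\<close> is
  missing. One low face is first rebuilt by inverting alpha (here and in \<open>cube_hhl\<close>),
  beta (\<open>cube_hlh\<close>) or S (\<open>cube_hhh\<close>); an earlier corner then gives a
  cube, and uniqueness identifies its remaining face.\<close>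

lemma cube_lhh:
  assumes "sideways x y y1 x2" "sideways y1 z1 A B" "sideways x2 z2 A C"
  obtains z x3 y3 where "cube x y z y1 x2 z1 x3 z2 y3 A B C"
proof -
  obtain z x3 where f: "sideways x z z1 x3"
    using assms sideways_exists_xs sideways_closed by metis
  obtain z2' y3 C' where c: "cube x y z y1 x2 z1 x3 z2' y3 A B C'"
    using cube_lhl[OF assms(1,2) f] by metis
  then have "z2' = z2" "C' = C"
    using assms unfolding cube_def by (auto dest: sideways_unique_xs)
  then show ?thesis using c that by simp
qed

lemma cube_hlh:
  assumes "sideways x3 y3 B C" "sideways y z z2 y3" "sideways x2 z2 A C"
  obtains x y1 z1 where "cube x y z y1 x2 z1 x3 z2 y3 A B C"
proof -
  obtain x z1 where f: "sideways x z z1 x3"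
    using assms sideways_exists_yt sideways_closed by metis
  obtain y1 x2' A' where c: "cube x y z y1 x2' z1 x3 z2 y3 A' B C"
    using cube_hll[OF assms(1,2) f] by metis
  then have "x2' = x2" "A' = A"
    using assms unfolding cube_def by (auto dest: sideways_unique_yt)
  then show ?thesis using c that by simp
qed

lemma cube_hhl:
  assumes "sideways x3 y3 B C" "sideways y1 z1 A B" "sideways x z z1 x3"
  obtains y x2 z2 where "cube x y z y1 x2 z1 x3 z2 y3 A B C"
proof -
  obtain y x2 where f: "sideways x y y1 x2"
    using assms sideways_exists_xs sideways_closed by metis
  obtain z2 y3' C' where c: "cube x y z y1 x2 z1 x3 z2 y3' A B C'"
    using cube_lhl[OF f assms(2,3)] by metis
  then have "y3' = y3" "C' = C"
    using assms unfolding cube_def by (auto dest: sideways_unique_xs)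
  then show ?thesis using c that by simp
qed

lemma cube_hhh:
  assumes "sideways x3 y3 B C" "sideways y1 z1 A B" "sideways x2 z2 A C"
  obtains x y z where "cube x y z y1 x2 z1 x3 z2 y3 A B C"
proof -
  obtain x y where f: "sideways x y y1 x2"
    using assms sideways_exists_st sideways_closed by metis
  obtain z x3' y3' where c: "cube x y z y1 x2 z1 x3' z2 y3' A B C"
    using cube_lhh[OF f assms(2,3)] by metis
  then have "x3' = x3" "y3' = y3"
    using assms unfolding cube_def by (auto dest: sideways_unique_st)
  then show ?thesis using c that by simp
qed

text \<open>Six height orders and three detours. The missing sign patterns, Positive Negative
  Positive and its opposite, would put the strands over one another cyclically.\<close>

lemma triangle_kinds_cases:
  assumes "triangle_kinds k12 k13 k23"
  obtains "k12 = Positive" "k13 = Positive" "k23 = Positive"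
  | "k12 = Positive" "k13 = Positive" "k23 = Negative"
  | "k12 = Negative" "k13 = Positive" "k23 = Positive"
  | "k12 = Positive" "k13 = Negative" "k23 = Negative"
  | "k12 = Negative" "k13 = Negative" "k23 = Positive"
  | "k12 = Negative" "k13 = Negative" "k23 = Negative"
  | "k12 = Virtual" "k13 = Virtual"
  | "k12 = Virtual" "k23 = Virtual"
  | "k13 = Virtual" "k23 = Virtual"
  using assms by cases (auto split: if_splits)

text \<open>With three positive crossings the sides before and after the move are the right and the
  left side of condition (iii), for x = \<open>c\<close>, y = \<open>q'\<close>, z =
  \<open>a'\<close>.\<close>

lemma braid_triangle:
  assumes "triangle_kinds k12 k13 k23"
    and "admissible k12 a b p q" "admissible k13 q c r a'" "admissible k23 p r c' b'"
  shows "\<exists>p' q' r'. admissible k23 b c p' q' \<and> admissible k13 a p' c' r' \<and>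
    admissible k12 r' q' b' a' \<and>
    weight k23 b c p' q' + weight k13 a p' c' r' + weight k12 r' q' b' a' =
    weight k12 a b p q + weight k13 q c r a' + weight k23 p r c' b'"
proof -
  note closed = assms(2-4)[THEN admissible_closed(1)] assms(2-4)[THEN admissible_closed(2)]
    assms(2-4)[THEN admissible_closed(3)] assms(2-4)[THEN admissible_closed(4)]
  show ?thesis
    \<comment> \<open>In the detour cases \<open>simp\<close> finishes, because virtual crossings
      just copy colors. In the classical cases the pattern of shared edges selects the corner; the
      antipodal corner supplies the witnesses, and \<open>algebra_simps\<close> moves terms to match
      the signs.\<close>
    by (insert assms(2-) closed; cases rule: triangle_kinds_cases[OF assms(1)]; simp;
        ((erule (2) cube_lll | erule (2) cube_hll | erule (2) cube_lhl | erule (2) cube_llh |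
         erule (2) cube_lhh | erule (2) cube_hlh | erule (2) cube_hhl | erule (2) cube_hhh),
         unfold cube_def, elim conjE, intro exI conjI, assumption, assumption, assumption,
         simp add: algebra_simps)?)
qed

lemma braid_triangle_reverse:
  assumes "triangle_kinds k12 k13 k23"
    and "admissible k23 b c p' q'" "admissible k13 a p' c' r'" "admissible k12 r' q' b' a'"
  shows "\<exists>p q r. admissible k12 a b p q \<and> admissible k13 q c r a' \<and> admissible k23 p r c' b' \<and>
    weight k12 a b p q + weight k13 q c r a' + weight k23 p r c' b' =
    weight k23 b c p' q' + weight k13 a p' c' r' + weight k12 r' q' b' a'"
proof -
  note closed = assms(2-4)[THEN admissible_closed(1)] assms(2-4)[THEN admissible_closed(2)]
    assms(2-4)[THEN admissible_closed(3)] assms(2-4)[THEN admissible_closed(4)]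
  show ?thesis
    by (insert assms(2-) closed; cases rule: triangle_kinds_cases[OF assms(1)]; simp;
        ((erule (2) cube_lll | erule (2) cube_hll | erule (2) cube_lhl | erule (2) cube_llh |
         erule (2) cube_lhh | erule (2) cube_hlh | erule (2) cube_hhl | erule (2) cube_hhh),
         unfold cube_def, elim conjE, intro exI conjI, assumption, assumption, assumption,
         simp add: algebra_simps)?)
qed

text \<open>The internal edges lie on the left of every crossing before the move and on the right
  after it. Whatever the signs, they are thus \<open>A\<close>, \<open>B\<close>, \<open>C\<close>
  before and \<open>x\<close>, \<open>y\<close>, \<open>z\<close> after: the corners
  \<open>hhh\<close> and \<open>lll\<close>.\<close>

lemma cyclic_triangle:
  assumes "triangle_kinds k12 k13 k23"
    and "admissible k12 p b q a'" "admissible k23 q c r b'" "admissible (opposite k13) r a p c'"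
  shows "\<exists>p' q' r'. admissible k12 a q' b' p' \<and> admissible k23 b r' c' q' \<and>
    admissible (opposite k13) c p' a' r' \<and>
    weight k12 a q' b' p' + weight k23 b r' c' q' + weight (opposite k13) c p' a' r' =
    weight k12 p b q a' + weight k23 q c r b' + weight (opposite k13) r a p c'"
proof -
  note closed = assms(2-4)[THEN admissible_closed(1)] assms(2-4)[THEN admissible_closed(2)]
    assms(2-4)[THEN admissible_closed(3)] assms(2-4)[THEN admissible_closed(4)]
  show ?thesis
    by (insert assms(2-) closed; cases rule: triangle_kinds_cases[OF assms(1)]; simp;
        ((erule (2) cube_lll | erule (2) cube_hll | erule (2) cube_lhl | erule (2) cube_llh |
         erule (2) cube_lhh | erule (2) cube_hlh | erule (2) cube_hhl | erule (2) cube_hhh),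
         unfold cube_def, elim conjE, intro exI conjI, assumption, assumption, assumption,
         simp add: algebra_simps)?)
qed

lemma cyclic_triangle_reverse:
  assumes "triangle_kinds k12 k13 k23"
    and "admissible k12 a q' b' p'" "admissible k23 b r' c' q'"
      "admissible (opposite k13) c p' a' r'"
  shows "\<exists>p q r. admissible k12 p b q a' \<and> admissible k23 q c r b' \<and>
    admissible (opposite k13) r a p c' \<and>
    weight k12 p b q a' + weight k23 q c r b' + weight (opposite k13) r a p c' =
    weight k12 a q' b' p' + weight k23 b r' c' q' + weight (opposite k13) c p' a' r'"
proof -
  note closed = assms(2-4)[THEN admissible_closed(1)] assms(2-4)[THEN admissible_closed(2)]
    assms(2-4)[THEN admissible_closed(3)] assms(2-4)[THEN admissible_closed(4)]
  show ?thesis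
    by (insert assms(2-) closed; cases rule: triangle_kinds_cases[OF assms(1)]; simp;
        ((erule (2) cube_lll | erule (2) cube_hll | erule (2) cube_lhl | erule (2) cube_llh |
         erule (2) cube_lhh | erule (2) cube_hlh | erule (2) cube_hhl | erule (2) cube_hhh),
         unfold cube_def, elim conjE, intro exI conjI, assumption, assumption, assumption,
         simp add: algebra_simps)?)
qed


section \<open>Colorings under Reidemeister moves\<close>

text \<open>Membership in \<open>X\<close> is demanded at each vertex, so that being a coloring
  splits along a union of codes; points and virtual crossings alone would not enforce it.\<close>

definition colored :: "(nat \<Rightarrow> 'a) \<Rightarrow> nat vertex \<Rightarrow> bool" where
  "colored f v \<longleftrightarrow> colored_at X un ov f v \<and> f ` ends v \<subseteq> X"

definition colors :: "(nat \<Rightarrow> 'a) \<Rightarrow> diagram \<Rightarrow> bool" where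
  "colors f D \<longleftrightarrow> (\<forall>v\<in>#D. colored f v)"

lemma colors_simps [simp]:
  "colors f {#}"
  "colors f (add_mset v D) \<longleftrightarrow> colored f v \<and> colors f D"
  "colors f (C + D) \<longleftrightarrow> colors f C \<and> colors f D"
  by (auto simp: colors_def)

lemma colored_Point [simp]: "colored f (Point a b) \<longleftrightarrow> f a \<in> X \<and> f a = f b"
  by (auto simp: colored_def)

lemma colored_Crossing [simp]:
  "colored f (Crossing k sw se nw ne) \<longleftrightarrow> admissible k (f sw) (f se) (f nw) (f ne)"
  by (cases k) (auto simp: colored_def sideways_def under_closed over_closed)

text \<open>The routes add up to the positive weight or to minus the negative weight; condition (ii)
  replaces the latter by \<open>P\<close>. The three fare types are treated alike
  afterwards.\<close>

lemma crossing_fare: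
  assumes "admissible k (f sw) (f se) (f nw) (f ne)"
  shows "(\<Sum>(s, t)\<leftarrow>routes \<tau> (Crossing k sw se nw ne).
      signed (Crossing k sw se nw ne) (\<phi> (f s) (f t))) =
    weight k (f sw) (f se) (f nw) (f ne)"
proof (cases k)
  case Positive
  then have weight: "weight k (f sw) (f se) (f nw) (f ne) = P (f se) (f ne)" by simp
  show ?thesis
    using Positive assms unfolding weight by (cases \<tau>) (auto simp: sideways_def algebra_simps)
next
  case Negative
  then have "sideways (f ne) (f se) (f nw) (f sw)" using assms by simp
  moreover from this have weight:
    "weight k (f sw) (f se) (f nw) (f ne) = - negative_weight \<tau> un ov \<phi> (f ne) (f se)"
    using Negative by (simp add: negative_weight_eq sideways_def)
  ultimately show ?thesis
    using Negative unfolding weight by (cases \<tau>) (auto simp: sideways_def algebra_simps)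
qed simp

lemma total_fare_Crossing [simp]:
  "colored f (Crossing k sw se nw ne) \<Longrightarrow>
    total_fare \<tau> \<phi> f (add_mset (Crossing k sw se nw ne) D) =
    weight k (f sw) (f se) (f nw) (f ne) + total_fare \<tau> \<phi> f D"
  by (simp add: total_fare_add_mset crossing_fare)

lemma colors_cong:
  assumes "\<And>e. e \<in> edges D \<Longrightarrow> f e = g e"
  shows "colors f D \<longleftrightarrow> colors g D"
proof -
  have "colored f v \<longleftrightarrow> colored g v" if "v \<in># D" for v
  proof -
    have "f e = g e" if "e \<in> ends v" for e
      using assms ends_subset_edges[OF \<open>v \<in># D\<close>] that by blast
    then have "colored_at X un ov f v \<longleftrightarrow> colored_at X un ov g v" "f ` ends v = g ` ends v"
      by (auto intro!: colored_at_cong image_cong)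
    then show ?thesis by (simp add: colored_def)
  qed
  then show ?thesis by (simp add: colors_def)
qed

lemma colorings_eq: "colorings X un ov D = {f \<in> extensional (edges D). colors f D}"
  by (fastforce simp: colorings_def colors_def colored_def edges_eq_UN PiE_def Pi_iff)

lemma colors_map_vertex: "colors f (image_mset (map_vertex \<sigma>) D) \<longleftrightarrow> colors (f \<circ> \<sigma>) D"
  by (simp add: colors_def colored_def colored_at_map_vertex ends_map_vertex image_comp)

section \<open>Renaming edges and removing marked points\<close>

definition fare_spectrum :: "diagram \<Rightarrow> 'b multiset" where
  "fare_spectrum D = image_mset (\<lambda>f. total_fare \<tau> \<phi> f D) (mset_set (colorings X un ov D))"

text \<open>\<open>\<sigma>\<close> may merge edges, provided every coloring factors through it.
  This covers both an injective renaming and the merging of the two edges at a marked point.\<close>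

lemma fare_spectrum_relabel:
  assumes "\<And>f. f \<in> colorings X un ov D \<Longrightarrow> \<exists>g. \<forall>e\<in>edges D. f e = g (\<sigma> e)"
  shows "fare_spectrum D = fare_spectrum (image_mset (map_vertex \<sigma>) D)"
proof -
  let ?D' = "image_mset (map_vertex \<sigma>) D"
  let ?\<rho> = "\<lambda>f. restrict (f \<circ> \<sigma>) (edges D)"
  have "inj_on ?\<rho> (colorings X un ov ?D')"
  proof (rule inj_onI)
    fix f g
    assume *: "f \<in> colorings X un ov ?D'" "g \<in> colorings X un ov ?D'" and eq: "?\<rho> f = ?\<rho> g"
    have "f (\<sigma> e) = g (\<sigma> e)" if "e \<in> edges D" for e
      using fun_cong[OF eq, of e] that by simp
    then show "f = g"
      using * by (auto simp: colorings_eq edges_image_map_vertex intro!: extensionalityI)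
  qed
  moreover have "?\<rho> f' \<in> colorings X un ov D" if "f' \<in> colorings X un ov ?D'" for f'
  proof -
    have "colors (?\<rho> f') D \<longleftrightarrow> colors (f' \<circ> \<sigma>) D" by (rule colors_cong) simp
    then show ?thesis using that by (simp add: colorings_eq colors_map_vertex)
  qed
  moreover have "\<exists>f'\<in>colorings X un ov ?D'. ?\<rho> f' = f \<and>
      total_fare \<tau> \<phi> f' ?D' = total_fare \<tau> \<phi> f D" if f: "f \<in> colorings X un ov D" for f
  proof -
    obtain g where g: "\<forall>e\<in>edges D. f e = g (\<sigma> e)" using assms[OF f] by blast
    let ?g = "restrict g (\<sigma> ` edges D)"
    have *: "(?g \<circ> \<sigma>) e = f e" if "e \<in> edges D" for e using g that by simp
    have "colors (?g \<circ> \<sigma>) D"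
      using colors_cong[of D "?g \<circ> \<sigma>" f] * f by (simp add: colorings_eq)
    then have "?g \<in> colorings X un ov ?D'"
      by (simp add: colorings_eq colors_map_vertex edges_image_map_vertex)
    moreover have "?\<rho> ?g = f"
      using f * by (auto simp: colorings_eq intro!: extensionalityI[where A = "edges D"])
    moreover have "total_fare \<tau> \<phi> ?g ?D' = total_fare \<tau> \<phi> f D"
      using * by (auto simp only: total_fare_map_vertex intro: total_fare_cong)
    ultimately show ?thesis by blast
  qed
  ultimately show ?thesis
    unfolding fare_spectrum_def
    by (intro image_mset_mset_set_eqI[where \<rho> = "\<lambda>f. f" and \<rho>' = ?\<rho>]) auto
qed

lemma fare_spectrum_rename:
  assumes "inj_on \<pi> (edges D)"
  shows "fare_spectrum D = fare_spectrum (image_mset (map_vertex \<pi>) D)"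
proof (rule fare_spectrum_relabel)
  fix f
  show "\<exists>g. \<forall>e\<in>edges D. f e = g (\<pi> e)"
    using assms by (intro exI[of _ "f \<circ> inv_into (edges D) \<pi>"]) simp
qed

lemma fare_spectrum_unmark:
  assumes "well_formed (add_mset (Point a b) C)" and "a \<noteq> b"
  shows "fare_spectrum (add_mset (Point a b) C) =
    fare_spectrum (image_mset (map_vertex (id(b := a))) C)"
proof -
  let ?D = "add_mset (Point a b) C" and ?\<sigma> = "id(b := a)"
  have "count (arrivals ?D) b = 1" "count (departures ?D) a = 1"
    using assms(1) by (auto simp: well_formed_def)
  \<comment> \<open>The point holds only the arrival of \<open>a\<close> and the departure of
    \<open>b\<close>; their other ends must lie in \<open>C\<close>.\<close>
  then have "b \<in># arrivals C" "a \<in># departures C"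
    using \<open>a \<noteq> b\<close> by (auto simp flip: count_greater_zero_iff)
  then have ab: "a \<in> edges C" "b \<in> edges C" by (auto simp: edges_def)
  let ?C' = "image_mset (map_vertex ?\<sigma>) C" and ?D' = "image_mset (map_vertex ?\<sigma>) ?D"
  have "fare_spectrum ?D = fare_spectrum ?D'"
  proof (rule fare_spectrum_relabel)
    fix f
    assume "f \<in> colorings X un ov ?D"
    then have "f a = f b" by (simp add: colorings_eq)
    then show "\<exists>g. \<forall>e\<in>edges ?D. f e = g (?\<sigma> e)" by (intro exI[of _ f]) simp
  qed
  also have "\<dots> = fare_spectrum ?C'"
  proof -
    \<comment> \<open>The point has become \<open>Point a a\<close>, which only asks for
      \<open>f a \<in> X\<close>. Since \<open>a\<close> is still an edge of \<open>?C'\<close>,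
      deleting the point changes neither edges nor colorings.\<close>
    have a: "a \<in> edges ?C'" using ab by (auto simp: edges_image_map_vertex)
    then have "edges ?D' = edges ?C'" by auto
    moreover have "f a \<in> X" if "colors f ?C'" for f
      using that a by (fastforce simp: colors_def colored_def edges_eq_UN)
    ultimately have "colorings X un ov ?D' = colorings X un ov ?C'"
      by (auto simp: colorings_eq)
    then show ?thesis by (simp add: fare_spectrum_def)
  qed
  finally show ?thesis .
qed

section \<open>Exchanging a tangle inside a diagram\<close>

definition simulates :: "nat set \<Rightarrow> diagram \<Rightarrow> diagram \<Rightarrow> bool" where
  "simulates B T T' \<longleftrightarrow> (\<forall>f. colors f T \<longrightarrow>
    (\<exists>f'. colors f' T' \<and> (\<forall>e\<in>B. f' e = f e) \<and> total_fare \<tau> \<phi> f' T' = total_fare \<tau> \<phi> f T))"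

definition determined :: "nat set \<Rightarrow> diagram \<Rightarrow> bool" where
  "determined B T \<longleftrightarrow> (\<forall>f g. colors f T \<longrightarrow> colors g T \<longrightarrow>
    (\<forall>e\<in>B. f e = g e) \<longrightarrow> (\<forall>e\<in>edges T. f e = g e))"

definition tangle :: "nat set \<Rightarrow> diagram \<Rightarrow> diagram \<Rightarrow> bool" where
  "tangle B C T \<longleftrightarrow> B \<subseteq> edges T \<and> edges C \<inter> edges T \<subseteq> B \<and> determined B T"

text \<open>\<open>B\<close> is added to \<open>edges C\<close> because a boundary edge that both
  enters and leaves the tangle does not occur in \<open>C\<close>.\<close>

lemma tangle_inj_on:
  assumes "tangle B C T"
  shows "inj_on (\<lambda>f. restrict f (edges C \<union> B)) (colorings X un ov (C + T))"
proof (rule inj_onI)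
  fix f g
  assume *: "f \<in> colorings X un ov (C + T)" "g \<in> colorings X un ov (C + T)"
    and "restrict f (edges C \<union> B) = restrict g (edges C \<union> B)"
  then have outer: "f e = g e" if "e \<in> edges C \<union> B" for e
    using that by (metis restrict_apply')
  then have "\<forall>e\<in>edges T. f e = g e"
    using assms * by (auto simp: tangle_def determined_def colorings_eq)
  with outer * show "f = g"
    by (auto simp: colorings_eq intro!: extensionalityI[where A = "edges C \<union> edges T"])
qed

lemma simulates_extend:
  assumes "tangle B C T" "tangle B C T'" "simulates B T T'" and f: "f \<in> colorings X un ov (C + T)"
  shows "\<exists>f'\<in>colorings X un ov (C + T').
    restrict f' (edges C \<union> B) = restrict f (edges C \<union> B) \<and>
    total_fare \<tau> \<phi> f' (C + T') = total_fare \<tau> \<phi> f (C + T)"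
proof -
  have fC: "colors f C" and fT: "colors f T" using f by (auto simp: colorings_eq)
  from assms(3) fT obtain h where h: "colors h T'" "\<forall>e\<in>B. h e = f e"
    "total_fare \<tau> \<phi> h T' = total_fare \<tau> \<phi> f T"
    unfolding simulates_def by blast
  \<comment> \<open>The two definitions overlap only on \<open>B\<close>, where \<open>h\<close>
    agrees with \<open>f\<close>; \<open>undefined\<close> elsewhere makes the result
    extensional.\<close>
  define f' where "f' = (\<lambda>e. if e \<in> edges T' then h e else if e \<in> edges C then f e else undefined)"
  have T': "f' e = h e" if "e \<in> edges T'" for e using that by (simp add: f'_def)
  have C: "f' e = f e" if "e \<in> edges C" for e
    using that h(2) assms(2) by (auto simp: f'_def tangle_def)
  have B: "f' e = f e" if "e \<in> B" for e
    using that h(2) assms(2) T' by (auto simp: tangle_def)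
  have "f' \<in> extensional (edges C \<union> edges T')" by (simp add: f'_def extensional_def)
  then have "f' \<in> colorings X un ov (C + T')"
    using colors_cong[of C f' f] colors_cong[of T' f' h] C T' fC h(1) by (simp add: colorings_eq)
  moreover have "restrict f' (edges C \<union> B) = restrict f (edges C \<union> B)"
    using C B by (auto simp: restrict_def)
  moreover have "total_fare \<tau> \<phi> f' (C + T') = total_fare \<tau> \<phi> f (C + T)"
    using total_fare_cong[of C f' f \<tau> \<phi>] total_fare_cong[of T' f' h \<tau> \<phi>] C T' h(3) by simp
  ultimately show ?thesis by blast
qed

lemma fare_spectrum_local:
  assumes "tangle B C T" "tangle B C T'" "simulates B T T'" "simulates B T' T"
  shows "fare_spectrum (C + T) = fare_spectrum (C + T')"
  unfolding fare_spectrum_def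
  using tangle_inj_on[OF assms(1)] tangle_inj_on[OF assms(2)]
    simulates_extend[OF assms(1,2,3)] simulates_extend[OF assms(2,1,4)]
  by (intro image_mset_mset_set_eqI) blast+

subsection \<open>The local moves\<close>

lemma internal_edges:
  assumes "well_formed (C + T)" "\<And>e. e \<in> I \<Longrightarrow> e \<in># arrivals T \<and> e \<in># departures T"
    and "edges T \<subseteq> I \<union> B"
  shows "edges C \<inter> edges T \<subseteq> B"
  using assms well_formed_internal_edge[OF assms(1)] by blast

lemma R1_left_invariant:
  assumes "well_formed (C + {#Crossing k p a p a'#})"
  shows "fare_spectrum (C + {#Point a a'#}) = fare_spectrum (C + {#Crossing k p a p a'#})"
proof -
  have "distinct [p, a]" "distinct [p, a']"
    using well_formed_distinct_arrivals[OF assms, of "[p, a]"]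
      well_formed_distinct_departures[OF assms, of "[p, a']"] by auto
  then have [simp]: "a \<noteq> p" "a' \<noteq> p" by auto
  have "edges C \<inter> edges {#Crossing k p a p a'#} \<subseteq> {a, a'}"
    using assms by (rule internal_edges[where I = "{p}"]) auto
  moreover have "f p = g p"
    if "admissible k (f p) (f a) (f p) (f a')" "admissible k (g p) (g a) (g p) (g a')"
      "f a = g a" "f a' = g a'" for f g :: "nat \<Rightarrow> 'a"
    using that admissible_unique_left by metis
  ultimately have "tangle {a, a'} C {#Crossing k p a p a'#}"
    by (auto simp: tangle_def determined_def)
  moreover have "tangle {a, a'} C {#Point a a'#}"
    by (auto simp: tangle_def determined_def)
  moreover have "simulates {a, a'} {#Point a a'#} {#Crossing k p a p a'#}"
    unfolding simulates_def
  proof (intro allI impI)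
    fix f assume f: "colors f {#Point a a'#}"
    then have "f a \<in> X" by auto
    then obtain v where "admissible k v (f a) v (f a)"
      by (rule admissible_left_loop_exists)
    then show "\<exists>f'. colors f' {#Crossing k p a p a'#} \<and> (\<forall>e\<in>{a, a'}. f' e = f e) \<and>
        total_fare \<tau> \<phi> f' {#Crossing k p a p a'#} = total_fare \<tau> \<phi> f {#Point a a'#}"
      using f admissible_left_loop(2) by (intro exI[of _ "f(p := v)"]) auto
  qed
  moreover have "simulates {a, a'} {#Crossing k p a p a'#} {#Point a a'#}"
    unfolding simulates_def
    using admissible_left_loop admissible_closed(2) by fastforce
  ultimately show ?thesis by (intro fare_spectrum_local)
qed

lemma R1_right_invariant:
  assumes "well_formed (C + {#Crossing k a p a' p#})"
  shows "fare_spectrum (C + {#Point a a'#}) = fare_spectrum (C + {#Crossing k a p a' p#})"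
proof -
  have "distinct [a, p]" "distinct [a', p]"
    using well_formed_distinct_arrivals[OF assms, of "[a, p]"]
      well_formed_distinct_departures[OF assms, of "[a', p]"] by auto
  then have [simp]: "a \<noteq> p" "a' \<noteq> p" by auto
  have "edges C \<inter> edges {#Crossing k a p a' p#} \<subseteq> {a, a'}"
    using assms by (rule internal_edges[where I = "{p}"]) auto
  moreover have "f p = g p"
    if "admissible k (f a) (f p) (f a') (f p)" "admissible k (g a) (g p) (g a') (g p)"
      "f a = g a" "f a' = g a'" for f g :: "nat \<Rightarrow> 'a"
    using that admissible_unique_right by metis
  ultimately have "tangle {a, a'} C {#Crossing k a p a' p#}"
    by (auto simp: tangle_def determined_def)
  moreover have "tangle {a, a'} C {#Point a a'#}"
    by (auto simp: tangle_def determined_def)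
  moreover have "simulates {a, a'} {#Point a a'#} {#Crossing k a p a' p#}"
    unfolding simulates_def
  proof (intro allI impI)
    fix f assume f: "colors f {#Point a a'#}"
    then have "f a \<in> X" by auto
    then obtain v where "admissible k (f a) v (f a) v"
      by (rule admissible_right_loop_exists)
    then show "\<exists>f'. colors f' {#Crossing k a p a' p#} \<and> (\<forall>e\<in>{a, a'}. f' e = f e) \<and>
        total_fare \<tau> \<phi> f' {#Crossing k a p a' p#} = total_fare \<tau> \<phi> f {#Point a a'#}"
      using f admissible_right_loop(2) by (intro exI[of _ "f(p := v)"]) auto
  qed
  moreover have "simulates {a, a'} {#Crossing k a p a' p#} {#Point a a'#}"
    unfolding simulates_def
    using admissible_right_loop admissible_closed(1) by fastforce
  ultimately show ?thesis by (intro fare_spectrum_local)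
qed

lemma R2_parallel_invariant:
  assumes "well_formed (C + {#Crossing k a b p q, Crossing (opposite k) p q a' b'#})"
  shows "fare_spectrum (C + {#Point a a', Point b b'#}) =
    fare_spectrum (C + {#Crossing k a b p q, Crossing (opposite k) p q a' b'#})"
proof -
  let ?P = "{#Point a a', Point b b'#}" and ?T = "{#Crossing k a b p q,
    Crossing (opposite k) p q a' b'#}"
  have "distinct [a, b, p, q]" "distinct [p, q, a', b']"
    using well_formed_distinct_arrivals[OF assms, of "[a, b, p, q]"]
      well_formed_distinct_departures[OF assms, of "[p, q, a', b']"] by auto
  then have [simp]: "a \<noteq> p" "a' \<noteq> p" "b \<noteq> p" "b' \<noteq> p" "a \<noteq> q" "a' \<noteq> q" "b \<noteq> q" "b' \<noteq> q" "p \<noteq> q"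
    by auto
  have "edges C \<inter> edges ?T \<subseteq> {a, a', b, b'}"
    using assms by (rule internal_edges[where I = "{p, q}"]) auto
  moreover have "f p = g p \<and> f q = g q"
    if "admissible k (f a) (f b) (f p) (f q)" "admissible k (g a) (g b) (g p) (g q)"
      "f a = g a" "f a' = g a'" "f b = g b" "f b' = g b'" for f g :: "nat \<Rightarrow> 'a"
    using that admissible_unique_top by metis
  ultimately have "tangle {a, a', b, b'} C ?T"
    by (auto simp: tangle_def determined_def)
  moreover have "tangle {a, a', b, b'} C ?P"
    by (auto simp: tangle_def determined_def)
  moreover have "simulates {a, a', b, b'} ?P ?T"
    unfolding simulates_def
  proof (intro allI impI)
    fix f assume f: "colors f ?P"
    then have "f a \<in> X" "f b \<in> X" by auto
    then obtain v w where "admissible k (f a) (f b) v w"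
      by (rule admissible_exists_top)
    then show "\<exists>f'. colors f' ?T \<and> (\<forall>e\<in>{a, a', b, b'}. f' e = f e) \<and>
        total_fare \<tau> \<phi> f' ?T = total_fare \<tau> \<phi> f ?P"
      using f by (intro exI[of _ "f(p := v, q := w)"]) auto
  qed
  moreover have "simulates {a, a', b, b'} ?T ?P"
    unfolding simulates_def
  proof (intro allI impI)
    fix f assume f: "colors f ?T"
    \<comment> \<open>The second crossing is read upside down by \<open>admissible_opposite\<close>:
      two squares of one kind with the same top have the same bottom.\<close>
    then have "admissible k (f a) (f b) (f p) (f q)" "admissible k (f a') (f b') (f p) (f q)"
      by auto
    then have "f a = f a'" "f b = f b'" "f a \<in> X" "f b \<in> X"
      using admissible_unique_bottom admissible_closed by metis+
    then show "\<exists>f'. colors f' ?P \<and> (\<forall>e\<in>{a, a', b, b'}. f' e = f e) \<and>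
        total_fare \<tau> \<phi> f' ?P = total_fare \<tau> \<phi> f ?T"
      using f by (intro exI[of _ f]) auto
  qed
  ultimately show ?thesis by (intro fare_spectrum_local)
qed

text \<open>The boundary colors sit on the left of the crossings, so finding the internal colors
  means solving S(x,y) = (s,t): surjectivity of S is needed.\<close>

lemma R2_antiparallel_right_invariant:
  assumes "well_formed (C + {#Crossing k a q b' p, Crossing (opposite k) b p a' q#})"
  shows "fare_spectrum (C + {#Point a a', Point b b'#}) =
    fare_spectrum (C + {#Crossing k a q b' p, Crossing (opposite k) b p a' q#})"
proof -
  let ?P = "{#Point a a', Point b b'#}" and ?T = "{#Crossing k a q b' p,
    Crossing (opposite k) b p a' q#}"
  have "distinct [a, q, b, p]" "distinct [b', p, a', q]"
    using well_formed_distinct_arrivals[OF assms, of "[a, q, b, p]"]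
      well_formed_distinct_departures[OF assms, of "[b', p, a', q]"] by auto
  then have [simp]: "a \<noteq> p" "a' \<noteq> p" "b \<noteq> p" "b' \<noteq> p" "a \<noteq> q" "a' \<noteq> q" "b \<noteq> q" "b' \<noteq> q" "p \<noteq> q"
    by auto
  have "edges C \<inter> edges ?T \<subseteq> {a, a', b, b'}"
    using assms by (rule internal_edges[where I = "{p, q}"]) auto
  moreover have "f p = g p \<and> f q = g q"
    if "admissible k (f a) (f q) (f b') (f p)" "admissible k (g a) (g q) (g b') (g p)"
      "f a = g a" "f a' = g a'" "f b = g b" "f b' = g b'" for f g :: "nat \<Rightarrow> 'a"
    using that admissible_unique_right by metis
  ultimately have "tangle {a, a', b, b'} C ?T"
    by (auto simp: tangle_def determined_def)
  moreover have "tangle {a, a', b, b'} C ?P"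
    by (auto simp: tangle_def determined_def)
  moreover have "simulates {a, a', b, b'} ?P ?T"
    unfolding simulates_def
  proof (intro allI impI)
    fix f assume f: "colors f ?P"
    then have "f a \<in> X" "f b \<in> X" by auto
    then obtain v w where "admissible k (f a) w (f b) v"
      by (rule admissible_exists_right)
    then show "\<exists>f'. colors f' ?T \<and> (\<forall>e\<in>{a, a', b, b'}. f' e = f e) \<and>
        total_fare \<tau> \<phi> f' ?T = total_fare \<tau> \<phi> f ?P"
      using f by (intro exI[of _ "f(p := v, q := w)"]) auto
  qed
  moreover have "simulates {a, a', b, b'} ?T ?P"
    unfolding simulates_def
  proof (intro allI impI)
    fix f assume f: "colors f ?T"
    then have "admissible k (f a) (f q) (f b') (f p)" "admissible k (f a') (f q) (f b) (f p)"
      by auto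
    then have "f a = f a'" "f b = f b'" "f a \<in> X" "f b \<in> X"
      using admissible_unique_left admissible_closed by metis+
    then show "\<exists>f'. colors f' ?P \<and> (\<forall>e\<in>{a, a', b, b'}. f' e = f e) \<and>
        total_fare \<tau> \<phi> f' ?P = total_fare \<tau> \<phi> f ?T"
      using f by (intro exI[of _ f]) auto
  qed
  ultimately show ?thesis by (intro fare_spectrum_local)
qed

text \<open>Mirror case: the internal colors are obtained by applying S, while injectivity of S
  makes the boundary colors match.\<close>

lemma R2_antiparallel_left_invariant:
  assumes "well_formed (C + {#Crossing k q a p b', Crossing (opposite k) p b q a'#})"
  shows "fare_spectrum (C + {#Point a a', Point b b'#}) =
    fare_spectrum (C + {#Crossing k q a p b', Crossing (opposite k) p b q a'#})"
proof -
  let ?P = "{#Point a a', Point b b'#}" and ?T = "{#Crossing k q a p b',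
    Crossing (opposite k) p b q a'#}"
  have "distinct [q, a, p, b]" "distinct [p, b', q, a']"
    using well_formed_distinct_arrivals[OF assms, of "[q, a, p, b]"]
      well_formed_distinct_departures[OF assms, of "[p, b', q, a']"] by auto
  then have [simp]: "a \<noteq> p" "a' \<noteq> p" "b \<noteq> p" "b' \<noteq> p" "a \<noteq> q" "a' \<noteq> q" "b \<noteq> q" "b' \<noteq> q" "p \<noteq> q"
    by auto
  have "edges C \<inter> edges ?T \<subseteq> {a, a', b, b'}"
    using assms by (rule internal_edges[where I = "{p, q}"]) auto
  moreover have "f p = g p \<and> f q = g q"
    if "admissible k (f q) (f a) (f p) (f b')" "admissible k (g q) (g a) (g p) (g b')"
      "f a = g a" "f a' = g a'" "f b = g b" "f b' = g b'" for f g :: "nat \<Rightarrow> 'a"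
    using that admissible_unique_left by metis
  ultimately have "tangle {a, a', b, b'} C ?T"
    by (auto simp: tangle_def determined_def)
  moreover have "tangle {a, a', b, b'} C ?P"
    by (auto simp: tangle_def determined_def)
  moreover have "simulates {a, a', b, b'} ?P ?T"
    unfolding simulates_def
  proof (intro allI impI)
    fix f assume f: "colors f ?P"
    then have "f a \<in> X" "f b \<in> X" by auto
    then obtain v w where "admissible k w (f a) v (f b)"
      by (rule admissible_exists_left)
    then show "\<exists>f'. colors f' ?T \<and> (\<forall>e\<in>{a, a', b, b'}. f' e = f e) \<and>
        total_fare \<tau> \<phi> f' ?T = total_fare \<tau> \<phi> f ?P"
      using f by (intro exI[of _ "f(p := v, q := w)"]) auto
  qed
  moreover have "simulates {a, a', b, b'} ?T ?P"
    unfolding simulates_def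
  proof (intro allI impI)
    fix f assume f: "colors f ?T"
    then have "admissible k (f q) (f a) (f p) (f b')" "admissible k (f q) (f a') (f p) (f b)"
      by auto
    then have "f a = f a'" "f b = f b'" "f a \<in> X" "f b \<in> X"
      using admissible_unique_right admissible_closed by metis+
    then show "\<exists>f'. colors f' ?P \<and> (\<forall>e\<in>{a, a', b, b'}. f' e = f e) \<and>
        total_fare \<tau> \<phi> f' ?P = total_fare \<tau> \<phi> f ?T"
      using f by (intro exI[of _ f]) auto
  qed
  ultimately show ?thesis by (intro fare_spectrum_local)
qed

lemma R3_braid_invariant:
  assumes "triangle_kinds k12 k13 k23"
    and before: "well_formed (C + {#Crossing k12 a b p q, Crossing k13 q c r a',
      Crossing k23 p r c' b'#})"
    and after: "well_formed (C + {#Crossing k23 b c p' q', Crossing k13 a p' c' r',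
      Crossing k12 r' q' b' a'#})"
  shows "fare_spectrum (C + {#Crossing k12 a b p q, Crossing k13 q c r a',
    Crossing k23 p r c' b'#}) =
    fare_spectrum (C + {#Crossing k23 b c p' q', Crossing k13 a p' c' r',
      Crossing k12 r' q' b' a'#})"
proof -
  let ?T = "{#Crossing k12 a b p q, Crossing k13 q c r a', Crossing k23 p r c' b'#}"
    and ?T' = "{#Crossing k23 b c p' q', Crossing k13 a p' c' r', Crossing k12 r' q' b' a'#}"
  have "distinct [a, b, q, c, p, r]" "distinct [p, q, r, a', c', b']"
    using well_formed_distinct_arrivals[OF before, of "[a, b, q, c, p, r]"]
      well_formed_distinct_departures[OF before, of "[p, q, r, a', c', b']"]
    by (auto simp: ac_simps)
  then have [simp]: "a \<noteq> p" "b \<noteq> p" "c \<noteq> p" "a' \<noteq> p" "b' \<noteq> p" "c' \<noteq> p" "a \<noteq> q" "b \<noteq> q" "c \<noteq> q"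
    "a' \<noteq> q" "b' \<noteq> q" "c' \<noteq> q" "a \<noteq> r" "b \<noteq> r" "c \<noteq> r" "a' \<noteq> r" "b' \<noteq> r" "c' \<noteq> r"
    "p \<noteq> q" "p \<noteq> r" "q \<noteq> r"
    by auto
  have "edges C \<inter> edges ?T \<subseteq> {a, b, c, a', b', c'}"
    using before by (rule internal_edges[where I = "{p, q, r}"]) auto
  \<comment> \<open>Colors propagate upwards: \<open>a\<close>, \<open>b\<close> determine
    \<open>p\<close>, \<open>q\<close>, and then \<open>q\<close>, \<open>c\<close> determine
    \<open>r\<close>.\<close>
  moreover have "f p = g p \<and> f q = g q \<and> f r = g r"
    if "admissible k12 (f a) (f b) (f p) (f q)" "admissible k13 (f q) (f c) (f r) (f a')"
      "admissible k12 (g a) (g b) (g p) (g q)" "admissible k13 (g q) (g c) (g r) (g a')"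
      "\<forall>e\<in>{a, b, c, a', b', c'}. f e = g e" for f g :: "nat \<Rightarrow> 'a"
    using that by simp (metis admissible_unique_top)
  ultimately have tangle: "tangle {a, b, c, a', b', c'} C ?T"
    by (auto simp: tangle_def determined_def)
  have "distinct [b, c, a, p', r', q']" "distinct [p', q', c', r', b', a']"
    using well_formed_distinct_arrivals[OF after, of "[b, c, a, p', r', q']"]
      well_formed_distinct_departures[OF after, of "[p', q', c', r', b', a']"]
    by (auto simp: ac_simps)
  then have [simp]: "a \<noteq> p'" "b \<noteq> p'" "c \<noteq> p'" "a' \<noteq> p'" "b' \<noteq> p'" "c' \<noteq> p'" "a \<noteq> q'" "b \<noteq> q'"
    "c \<noteq> q'"
    "a' \<noteq> q'" "b' \<noteq> q'" "c' \<noteq> q'" "a \<noteq> r'" "b \<noteq> r'" "c \<noteq> r'" "a' \<noteq> r'" "b' \<noteq> r'" "c' \<noteq> r'"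
    "p' \<noteq> q'" "p' \<noteq> r'" "q' \<noteq> r'"
    by auto
  have "edges C \<inter> edges ?T' \<subseteq> {a, b, c, a', b', c'}"
    using after by (rule internal_edges[where I = "{p', q', r'}"]) auto
  moreover have "f p' = g p' \<and> f q' = g q' \<and> f r' = g r'"
    if "admissible k23 (f b) (f c) (f p') (f q')" "admissible k13 (f a) (f p') (f c') (f r')"
      "admissible k23 (g b) (g c) (g p') (g q')" "admissible k13 (g a) (g p') (g c') (g r')"
      "\<forall>e\<in>{a, b, c, a', b', c'}. f e = g e" for f g :: "nat \<Rightarrow> 'a"
    using that by simp (metis admissible_unique_top)
  ultimately have tangle': "tangle {a, b, c, a', b', c'} C ?T'"
    by (auto simp: tangle_def determined_def)
  have "simulates {a, b, c, a', b', c'} ?T ?T'"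
    unfolding simulates_def
  proof (intro allI impI)
    fix f assume f: "colors f ?T"
    then obtain u v w where
      "admissible k23 (f b) (f c) u v"
      "admissible k13 (f a) u (f c') w"
      "admissible k12 w v (f b') (f a')"
      "weight k23 (f b) (f c) u v + weight k13 (f a) u (f c') w + weight k12 w v (f b') (f a') =
        weight k12 (f a) (f b) (f p) (f q) + weight k13 (f q) (f c) (f r) (f a') +
          weight k23 (f p) (f r) (f c') (f b')"
      using braid_triangle[OF assms(1), of "f a" "f b" "f p" "f q" "f c" "f r" "f a'" "f c'"
        "f b'"] by auto
    then show "\<exists>f'. colors f' ?T' \<and> (\<forall>e\<in>{a, b, c, a', b', c'}. f' e = f e) \<and>
        total_fare \<tau> \<phi> f' ?T' = total_fare \<tau> \<phi> f ?T"
      using f by (intro exI[of _ "f(p' := u, q' := v, r' := w)"]) (auto simp: ac_simps)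
  qed
  moreover have "simulates {a, b, c, a', b', c'} ?T' ?T"
    unfolding simulates_def
  proof (intro allI impI)
    fix f assume f: "colors f ?T'"
    then obtain u v w where
      "admissible k12 (f a) (f b) u v"
      "admissible k13 v (f c) w (f a')"
      "admissible k23 u w (f c') (f b')"
      "weight k12 (f a) (f b) u v + weight k13 v (f c) w (f a') + weight k23 u w (f c') (f b') =
        weight k23 (f b) (f c) (f p') (f q') + weight k13 (f a) (f p') (f c') (f r') +
          weight k12 (f r') (f q') (f b') (f a')"
      using braid_triangle_reverse[OF assms(1), of "f b" "f c" "f p'" "f q'" "f a" "f c'" "f r'"
        "f b'" "f a'"] by auto
    then show "\<exists>f'. colors f' ?T \<and> (\<forall>e\<in>{a, b, c, a', b', c'}. f' e = f e) \<and>
        total_fare \<tau> \<phi> f' ?T = total_fare \<tau> \<phi> f ?T'"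
      using f by (intro exI[of _ "f(p := u, q := v, r := w)"]) (auto simp: ac_simps)
  qed
  ultimately show ?thesis by (intro fare_spectrum_local[OF tangle tangle'])
qed

lemma R3_cyclic_invariant:
  assumes "triangle_kinds k12 k13 k23"
    and before: "well_formed (C + {#Crossing k12 p b q a', Crossing k23 q c r b',
      Crossing (opposite k13) r a p c'#})"
    and after: "well_formed (C + {#Crossing k12 a q' b' p', Crossing k23 b r' c' q',
      Crossing (opposite k13) c p' a' r'#})"
  shows "fare_spectrum (C + {#Crossing k12 p b q a', Crossing k23 q c r b',
    Crossing (opposite k13) r a p c'#}) =
    fare_spectrum (C + {#Crossing k12 a q' b' p', Crossing k23 b r' c' q',
      Crossing (opposite k13) c p' a' r'#})"
proof -
  let ?T = "{#Crossing k12 p b q a', Crossing k23 q c r b', Crossing (opposite k13) r a p c'#}"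
    and ?T' = "{#Crossing k12 a q' b' p', Crossing k23 b r' c' q',
      Crossing (opposite k13) c p' a' r'#}"
  have "distinct [p, b, q, c, r, a]" "distinct [q, a', r, b', p, c']"
    using well_formed_distinct_arrivals[OF before, of "[p, b, q, c, r, a]"]
      well_formed_distinct_departures[OF before, of "[q, a', r, b', p, c']"]
    by (auto simp: ac_simps)
  then have [simp]: "a \<noteq> p" "b \<noteq> p" "c \<noteq> p" "a' \<noteq> p" "b' \<noteq> p" "c' \<noteq> p" "a \<noteq> q" "b \<noteq> q" "c \<noteq> q"
    "a' \<noteq> q" "b' \<noteq> q" "c' \<noteq> q" "a \<noteq> r" "b \<noteq> r" "c \<noteq> r" "a' \<noteq> r" "b' \<noteq> r" "c' \<noteq> r"
    "p \<noteq> q" "p \<noteq> r" "q \<noteq> r"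
    by auto
  have "edges C \<inter> edges ?T \<subseteq> {a, b, c, a', b', c'}"
    using before by (rule internal_edges[where I = "{p, q, r}"]) auto
  \<comment> \<open>There is no lowest crossing in a cyclic triangle; instead the right sides
    \<open>b\<close>, \<open>a'\<close> and \<open>c\<close>, \<open>b'\<close> consist of boundary
    edges and determine the left ones.\<close>
  moreover have "f p = g p \<and> f q = g q \<and> f r = g r"
    if "admissible k12 (f p) (f b) (f q) (f a')" "admissible k23 (f q) (f c) (f r) (f b')"
      "admissible k12 (g p) (g b) (g q) (g a')" "admissible k23 (g q) (g c) (g r) (g b')"
      "\<forall>e\<in>{a, b, c, a', b', c'}. f e = g e" for f g :: "nat \<Rightarrow> 'a"
    using that by simp (metis admissible_unique_left)
  ultimately have tangle: "tangle {a, b, c, a', b', c'} C ?T"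
    by (auto simp: tangle_def determined_def)
  have "distinct [a, q', b, r', c, p']" "distinct [b', p', c', q', a', r']"
    using well_formed_distinct_arrivals[OF after, of "[a, q', b, r', c, p']"]
      well_formed_distinct_departures[OF after, of "[b', p', c', q', a', r']"]
    by (auto simp: ac_simps)
  then have [simp]: "a \<noteq> p'" "b \<noteq> p'" "c \<noteq> p'" "a' \<noteq> p'" "b' \<noteq> p'" "c' \<noteq> p'" "a \<noteq> q'" "b \<noteq> q'"
    "c \<noteq> q'"
    "a' \<noteq> q'" "b' \<noteq> q'" "c' \<noteq> q'" "a \<noteq> r'" "b \<noteq> r'" "c \<noteq> r'" "a' \<noteq> r'" "b' \<noteq> r'" "c' \<noteq> r'"
    "p' \<noteq> q'" "p' \<noteq> r'" "q' \<noteq> r'"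
    by auto
  have "edges C \<inter> edges ?T' \<subseteq> {a, b, c, a', b', c'}"
    using after by (rule internal_edges[where I = "{p', q', r'}"]) auto
  moreover have "f p' = g p' \<and> f q' = g q' \<and> f r' = g r'"
    if "admissible k12 (f a) (f q') (f b') (f p')" "admissible k23 (f b) (f r') (f c') (f q')"
      "admissible k12 (g a) (g q') (g b') (g p')" "admissible k23 (g b) (g r') (g c') (g q')"
      "\<forall>e\<in>{a, b, c, a', b', c'}. f e = g e" for f g :: "nat \<Rightarrow> 'a"
    using that by simp (metis admissible_unique_right)
  ultimately have tangle': "tangle {a, b, c, a', b', c'} C ?T'"
    by (auto simp: tangle_def determined_def)
  have "simulates {a, b, c, a', b', c'} ?T ?T'"
    unfolding simulates_def
  proof (intro allI impI)
    fix f assume f: "colors f ?T"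
    then obtain u v w where
      "admissible k12 (f a) v (f b') u"
      "admissible k23 (f b) w (f c') v"
      "admissible (opposite k13) (f c) u (f a') w"
      "weight k12 (f a) v (f b') u + weight k23 (f b) w (f c') v +
        weight (opposite k13) (f c) u (f a') w =
        weight k12 (f p) (f b) (f q) (f a') + weight k23 (f q) (f c) (f r) (f b') +
          weight (opposite k13) (f r) (f a) (f p) (f c')"
      using cyclic_triangle[OF assms(1), of "f p" "f b" "f q" "f a'" "f c" "f r" "f b'" "f a"
        "f c'"] by auto
    then show "\<exists>f'. colors f' ?T' \<and> (\<forall>e\<in>{a, b, c, a', b', c'}. f' e = f e) \<and>
        total_fare \<tau> \<phi> f' ?T' = total_fare \<tau> \<phi> f ?T"
      using f by (intro exI[of _ "f(p' := u, q' := v, r' := w)"]) (auto simp: ac_simps)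
  qed
  moreover have "simulates {a, b, c, a', b', c'} ?T' ?T"
    unfolding simulates_def
  proof (intro allI impI)
    fix f assume f: "colors f ?T'"
    then obtain u v w where
      "admissible k12 u (f b) v (f a')"
      "admissible k23 v (f c) w (f b')"
      "admissible (opposite k13) w (f a) u (f c')"
      "weight k12 u (f b) v (f a') + weight k23 v (f c) w (f b') +
        weight (opposite k13) w (f a) u (f c') =
        weight k12 (f a) (f q') (f b') (f p') + weight k23 (f b) (f r') (f c') (f q') +
          weight (opposite k13) (f c) (f p') (f a') (f r')"
      using cyclic_triangle_reverse[OF assms(1), of "f a" "f q'" "f b'" "f p'" "f b" "f r'" "f c'"
        "f c" "f a'"] by auto
    then show "\<exists>f'. colors f' ?T \<and> (\<forall>e\<in>{a, b, c, a', b', c'}. f' e = f e) \<and>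
        total_fare \<tau> \<phi> f' ?T = total_fare \<tau> \<phi> f ?T'"
      using f by (intro exI[of _ "f(p := u, q := v, r := w)"]) (auto simp: ac_simps)
  qed
  ultimately show ?thesis by (intro fare_spectrum_local[OF tangle tangle'])
qed

section \<open>Invariance under sequences of moves\<close>

lemma fare_spectrum_local_move:
  assumes "local_move T T'" "well_formed (C + T)" "well_formed (C + T')"
  shows "fare_spectrum (C + T) = fare_spectrum (C + T')"
  using assms
  by (cases rule: local_move.cases)
    (simp_all only: R1_left_invariant R1_right_invariant R2_parallel_invariant
      R2_antiparallel_right_invariant R2_antiparallel_left_invariant
      R3_braid_invariant R3_cyclic_invariant)

lemma fare_spectrum_reidemeister_move:
  assumes "reidemeister_move D D'"
  shows "fare_spectrum D = fare_spectrum D'"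
  using assms
  by cases (auto simp: link_diagram_def fare_spectrum_rename fare_spectrum_unmark
    fare_spectrum_local_move)

lemma fare_spectrum_reidemeister_equivalent:
  assumes "reidemeister_equivalent D D'"
  shows "fare_spectrum D = fare_spectrum D'"
  using assms unfolding reidemeister_equivalent_def
  by (induction rule: equivclp_induct) (auto dest: fare_spectrum_reidemeister_move)

end

theorem theorem2:
  fixes X :: "'a set"
    and un ov :: "'a \<Rightarrow> 'a \<Rightarrow> 'a"
    and \<phi> :: "'a \<Rightarrow> 'a \<Rightarrow> 'b::ab_group_add"
    and \<tau> :: fare_type
    and D D' :: diagram
  assumes "biquandle X un ov"
    and "finite X"
    and "biquandle_2_fare \<tau> X un ov \<phi>"
    and "link_diagram D"
    and "link_diagram D'"
    and "reidemeister_equivalent D D'"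
  shows "{# total_fare \<tau> \<phi> f D. f \<in># mset_set (colorings X un ov D) #} =
         {# total_fare \<tau> \<phi> f D'. f \<in># mset_set (colorings X un ov D') #}"
proof -
  interpret fare_biquandle X un ov \<tau> \<phi>
    using assms(1-3) by (simp add: fare_biquandle_def fare_biquandle_axioms_def)
  show ?thesis
    using fare_spectrum_reidemeister_equivalent[OF assms(6)] by (simp add: fare_spectrum_def)
qed

end
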